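(* Let $\mathcal S\subset\mathbb H^1$ be a $C^2$ graphical strip, and denote by $\sigma_H$ the sub-Riemannian volume form, or horizontal perimeter, on $\mathcal S$. Let $Q=4$. For every $p_0=(0,0,t_0)\in\mathcal S$ the function $$r\ \mapsto\ \frac{\sigma_H(\mathcal S\cap B(p_0,r))}{r^{Q-1}},\qquad r>0,$$ is monotone non-decreasing. Moreover, there exists $\omega>0$ such that $$\sigma_H(\mathcal S\cap B(p_0,r))\ \ge\ \omega\, r^{Q-1}\qquad\text{for every } r>0.$$
   Context: The first Heisenberg group $\mathbb H^1$ is $\mathbb R^3$ with the group law $(x,y,t)\cdot(x',y',t')=(x+x',y+y',t+t'+\tfrac12(xy'-x'y))$. Its left-invariant vector fields are $X_1=\partial_x-\frac y2\partial_t$, $X_2=\partial_y+\frac x2\partial_t$, $T=\partial_t$, and $\mathbb H^1$ carries the left-invariant Riemannian metric $\langle\cdot,\cdot\rangle$ making $X_1,X_2,T$ orthonormal. Its homogeneous dimension, associated with the dilations $\delta_\lambda(x,y,t)=(\lambda x,\lambda y,\lambda^2t)$, is $Q=4$. A $C^1$ surface $\mathcal S\subset\mathbb H^1$ is called a graphical strip if there exist an interval $I\subset\mathbb R$ and $G\in C^1(I)$ with $G'\ge0$ on $I$ such that, after possibly a left-translation and a rotation about the $t$-axis, either $\mathcal S=\{(x,y,t)\in\mathbb H^1:(y,t)\in\mathbb R\times I,\ x=yG(t)\}$ or $\mathcal S=\{(x,y,t)\in\mathbb H^1:(x,t)\in\mathbb R\times I,\ y=-xG(t)\}$. For a $C^1$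 surface $\mathcal S\subset\mathbb H^1$ with Riemannian unit normal $\boldsymbol\nu$ and Riemannian surface measure $\sigma$, the horizontal perimeter measure on $\mathcal S$ is $d\sigma_H=W\,d\sigma$, where $W=\sqrt{\langle\boldsymbol\nu,X_1\rangle^2+\langle\boldsymbol\nu,X_2\rangle^2}$. The gauge ball is $B(p_0,r)=\{p\in\mathbb H^1: N(p_0^{-1}p)<r\}$, where $N(x,y,t)=\big((x^2+y^2)^2+16t^2\big)^{1/4}$.
   Formalization: "Every r>0" fails if I is not all of R (e.g. G=0, I=(-1,1)); both claims are stated for r>0 with (t0-r²/4, t0+r²/4) inside I, which is all r>0 when I=R. For a translated or rotated strip, p0 is a point with coordinates (0,0,t0) in its normalised position. *)

theory Defs
  imports "HOL-Analysis.Analysis"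
begin

section \<open>The first Heisenberg group\<close>

text \<open>Points of the group and tangent vectors (in the coordinate basis
  \<open>\<partial>\<^sub>x, \<partial>\<^sub>y, \<partial>\<^sub>t\<close>) are both elements of \<open>\<real> \<times> \<real> \<times> \<real>\<close>.\<close>

type_synonym heis = "real \<times> real \<times> real"

fun hmul :: "heis \<Rightarrow> heis \<Rightarrow> heis" where
  "hmul (x, y, t) (x', y', t') = (x + x', y + y', t + t' + (x * y' - x' * y) / 2)"

fun hinv :: "heis \<Rightarrow> heis" where
  "hinv (x, y, t) = (- x, - y, - t)"

fun rot :: "real \<Rightarrow> heis \<Rightarrow> heis" where
  "rot \<theta> (x, y, t) = (x * cos \<theta> - y * sin \<theta>, x * sin \<theta> + y * cos \<theta>, t)"

definition hom_dim :: nat where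
  "hom_dim = 4"

fun X1 :: "heis \<Rightarrow> heis" where "X1 (x, y, t) = (1, 0, - y / 2)"
fun X2 :: "heis \<Rightarrow> heis" where "X2 (x, y, t) = (0, 1, x / 2)"
fun TT :: "heis \<Rightarrow> heis" where "TT (x, y, t) = (0, 0, 1)"

text \<open>Coefficients of a tangent vector at a point with respect to the frame
  \<open>X1, X2, TT\<close>; the metric is the one for which this frame is orthonormal
  (lemmas \<open>frame_coords_expand\<close> and \<open>frame_orthonormal\<close>).\<close>

fun frame_coords :: "heis \<Rightarrow> heis \<Rightarrow> real \<times> real \<times> real" where
  "frame_coords (x, y, t) (a, b, c) = (a, b, c + (y * a - x * b) / 2)"

definition riem :: "heis \<Rightarrow> heis \<Rightarrow> heis \<Rightarrow> real" where
  "riem p v w = frame_coords p v \<bullet> frame_coords p w"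

definition gauge :: "heis \<Rightarrow> real" where
  "gauge = (\<lambda>(x, y, t). root 4 ((x\<^sup>2 + y\<^sup>2)\<^sup>2 + 16 * t\<^sup>2))"

definition gauge_ball :: "heis \<Rightarrow> real \<Rightarrow> heis set" where
  "gauge_ball p0 r = {p. gauge (hmul (hinv p0) p) < r}"

lemma hmul_hinv: "hmul (hinv p) p = (0, 0, 0)"
  by (cases p) auto

lemma hmul_assoc: "hmul (hmul p q) r = hmul p (hmul q r)"
  by (cases p; cases q; cases r) (simp add: field_simps)

lemma frame_coords_expand:
  "frame_coords p v = (a, b, c) \<Longrightarrow> v = a *\<^sub>R X1 p + b *\<^sub>R X2 p + c *\<^sub>R TT p"
  by (cases p; cases v) (auto simp: field_simps)

lemma frame_orthonormal:
  "riem p (X1 p) (X1 p) = 1" "riem p (X2 p) (X2 p) = 1" "riem p (TT p) (TT p) = 1"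
  "riem p (X1 p) (X2 p) = 0" "riem p (X1 p) (TT p) = 0" "riem p (X2 p) (TT p) = 0"
  by (cases p; simp add: riem_def)+


section \<open>Horizontal perimeter of a surface\<close>

text \<open>\<open>D u\<close> is the differential of \<open>\<phi>\<close> at \<open>u\<close>. The parameter domain need not be open, so that
  surfaces with boundary are covered; its frontier is required to be negligible, so that the
  one-sided differentials there play no role in integrals.\<close>

definition C1_parametrization ::
  "(real^2) set \<Rightarrow> (real^2 \<Rightarrow> heis) \<Rightarrow> (real^2 \<Rightarrow> real^2 \<Rightarrow> heis) \<Rightarrow> heis set \<Rightarrow> bool" where
  "C1_parametrization U \<phi> D S \<longleftrightarrow>
     negligible (frontier U) \<and> bij_betw \<phi> U S \<and>
     (\<forall>u\<in>U. (\<phi> has_derivative D u) (at u within U) \<and> inj (D u)) \<and>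
     (\<forall>e. continuous_on U (\<lambda>u. D u e))"

text \<open>The Riemannian area of the parallelogram spanned at \<open>p\<close> by the images of the coordinate
  vectors (square root of the Gram determinant).\<close>

definition area_element :: "heis \<Rightarrow> (real^2 \<Rightarrow> heis) \<Rightarrow> real" where
  "area_element p A =
     (let v = A (axis 1 1); w = A (axis 2 1)
      in sqrt (riem p v v * riem p w w - (riem p v w)\<^sup>2))"

text \<open>Riemannian surface measure, for a surface with a global \<open>C\<^sup>1\<close> parametrization (every
  graphical strip has one). By the change of variables formula the result does
  not depend on the parametrization chosen.\<close>

definition surface_measure :: "heis set \<Rightarrow> heis measure" where
  "surface_measure S =
     (case SOME (U, \<phi>, D). C1_parametrization U \<phi> D S of (U, \<phi>, D) \<Rightarrow>
        distr (density (lebesgue_on U) (\<lambda>u. ennreal (area_element (\<phi> u) (D u))))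
          (restrict_space borel S) \<phi>)"

text \<open>Velocities at \<open>p\<close> of curves issuing from \<open>p\<close> and running in \<open>S\<close>. At interior points
  of a \<open>C\<^sup>1\<close> surface these form the tangent plane, at boundary points a half-plane
  spanning it.\<close>

definition tangent_vectors :: "heis set \<Rightarrow> heis \<Rightarrow> heis set" where
  "tangent_vectors S p =
     {v. \<exists>\<gamma>. \<gamma> 0 = p \<and> \<gamma> ` {0..1} \<subseteq> S \<and>
             (\<gamma> has_vector_derivative v) (at (0::real) within {0..1})}"

text \<open>The unit normal is determined up to sign only, which does not affect \<open>W\<close>.\<close>

definition unit_normal :: "heis set \<Rightarrow> heis \<Rightarrow> heis" where
  "unit_normal S p =
     (SOME \<nu>. riem p \<nu> \<nu> = 1 \<and> (\<forall>v\<in>tangent_vectors S p. riem p \<nu> v = 0))"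

definition W :: "heis set \<Rightarrow> heis \<Rightarrow> real" where
  "W S p = sqrt ((riem p (unit_normal S p) (X1 p))\<^sup>2 + (riem p (unit_normal S p) (X2 p))\<^sup>2)"

definition sigma_H :: "heis set \<Rightarrow> heis measure" where
  "sigma_H S = density (surface_measure S) (\<lambda>p. ennreal (W S p))"


section \<open>Graphical strips\<close>

text \<open>\<open>C\<^sup>k\<close> on an interval, with one-sided derivatives at endpoints.\<close>

fun Ck_on :: "nat \<Rightarrow> real set \<Rightarrow> (real \<Rightarrow> real) \<Rightarrow> bool" where
  "Ck_on 0 I f \<longleftrightarrow> continuous_on I f"
| "Ck_on (Suc k) I f \<longleftrightarrow>
     (\<exists>f'. (\<forall>t\<in>I. (f has_real_derivative f' t) (at t within I)) \<and> Ck_on k I f')"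

definition strip_x :: "real set \<Rightarrow> (real \<Rightarrow> real) \<Rightarrow> heis set" where
  "strip_x I G = {(x, y, t). t \<in> I \<and> x = y * G t}"

definition strip_y :: "real set \<Rightarrow> (real \<Rightarrow> real) \<Rightarrow> heis set" where
  "strip_y I G = {(x, y, t). t \<in> I \<and> y = - x * G t}"

text \<open>\<open>S\<close> is obtained from a model strip by a rotation about the \<open>t\<close>-axis followed by the left
  translation by \<open>q\<close>. A graph of this form is a \<open>C\<^sup>k\<close> surface precisely when \<open>G\<close>
  is \<open>C\<^sup>k\<close>. Intervals without interior are excluded since they do not give surfaces.
  The point that has coordinates \<open>(0, 0, t0)\<close> in the normalised position of \<open>S\<close> is
  \<open>hmul q (0, 0, t0)\<close>.\<close>

definition graphical_strip :: "nat \<Rightarrow> heis \<Rightarrow> heis set \<Rightarrow> bool" where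
  "graphical_strip k q S \<longleftrightarrow>
     (\<exists>I G \<theta>. is_interval I \<and> interior I \<noteq> {} \<and> Ck_on k I G \<and>
        (\<forall>t\<in>I. \<exists>d\<ge>0. (G has_real_derivative d) (at t within I)) \<and>
        (S = hmul q ` rot \<theta> ` strip_x I G \<or> S = hmul q ` rot \<theta> ` strip_y I G))"

text \<open>Radii \<open>r > 0\<close> for which \<open>S\<close> contains the part of its axis
  \<open>{q \<cdot> (0, 0, t)}\<close> lying in the ball \<open>B(p0, r)\<close>. For a strip over \<open>I = \<real>\<close> these are
  all \<open>r > 0\<close> (lemma \<open>strip_radii_UNIV\<close>). For a bounded interval and large \<open>r\<close> the strip
  ends inside the ball, and then neither monotonicity nor maximal growth can hold: for
  \<open>G = 0\<close> the perimeter in \<open>B(p0, r)\<close> grows only linearly in \<open>r\<close>.\<close>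

definition strip_radii :: "heis \<Rightarrow> heis set \<Rightarrow> heis \<Rightarrow> real set" where
  "strip_radii q S p0 =
     {r. 0 < r \<and> (\<forall>t. hmul q (0, 0, t) \<in> gauge_ball p0 r \<longrightarrow> hmul q (0, 0, t) \<in> S)}"

lemma strip_radii_interval:
  assumes "S = hmul q ` rot \<theta> ` strip_x I G \<or> S = hmul q ` rot \<theta> ` strip_y I G"
  shows "strip_radii q S (hmul q (0, 0, t0)) =
           {r. 0 < r \<and> {t0 - r\<^sup>2 / 4 <..< t0 + r\<^sup>2 / 4} \<subseteq> I}"
proof -
  obtain a b c where q: "q = (a, b, c)" by (cases q)
  have "(0, 0, t) \<in> rot \<theta> ` strip_x I G" "(0, 0, t) \<in> rot \<theta> ` strip_y I G" if "t \<in> I" for t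
    using that by (auto intro!: image_eqI[of _ _ "(0, 0, t)"] simp: strip_x_def strip_y_def)
  then have "hmul q (0, 0, t) \<in> S" if "t \<in> I" for t
    using assms that by blast
  moreover have "t \<in> I" if inS: "hmul q (0, 0, t) \<in> S" for t
  proof -
    obtain p where p: "p \<in> strip_x I G \<union> strip_y I G" "hmul q (0, 0, t) = hmul q (rot \<theta> p)"
      using assms inS by blast
    have "rot \<theta> p = (0, 0, t)"
      using p(2) by (cases "rot \<theta> p") (auto simp: q)
    then have "snd (snd p) = t"
      by (cases p) auto
    then show ?thesis
      using p(1) by (auto simp: strip_x_def strip_y_def)
  qed
  ultimately have S: "hmul q (0, 0, t) \<in> S \<longleftrightarrow> t \<in> I" for t
    by blast
  have B: "hmul q (0, 0, t) \<in> gauge_ball (hmul q (0, 0, t0)) r \<longleftrightarrow>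
             t \<in> {t0 - r\<^sup>2 / 4 <..< t0 + r\<^sup>2 / 4}" if "r > 0" for r t
  proof -
    have "root 4 (16 * (t - t0)\<^sup>2) < r \<longleftrightarrow> root 4 (16 * (t - t0)\<^sup>2) < root 4 (r ^ 4)"
      using that by (simp add: real_root_power_cancel)
    also have "\<dots> \<longleftrightarrow> (4 * (t - t0))\<^sup>2 < (r\<^sup>2)\<^sup>2"
      unfolding power_mult_distrib by simp
    also have "\<dots> \<longleftrightarrow> \<bar>4 * (t - t0)\<bar> < r\<^sup>2"
      by (metis abs_le_square_iff abs_of_nonneg linorder_not_less zero_le_power2)
    finally show ?thesis
      by (auto simp: gauge_ball_def gauge_def q field_simps abs_less_iff)
  qed
  show ?thesis
    using B S by (auto simp: strip_radii_def)
qed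

corollary strip_radii_UNIV:
  assumes "S = hmul q ` rot \<theta> ` strip_x UNIV G \<or> S = hmul q ` rot \<theta> ` strip_y UNIV G"
  shows "strip_radii q S (hmul q (0, 0, t0)) = {0<..}"
  using strip_radii_interval[OF assms] by auto

end

theory Submission
  imports Defs
begin

text \<open>
  Place the strip so that it is \<open>{x = y G(t)}\<close>, parametrised by \<open>(y, t)\<close>. In the orthonormal
  frame the two coordinate tangent vectors are \<open>(G, 1, 0)\<close> and \<open>(y G', 0, c)\<close> with
  \<open>c = 1 + y\<^sup>2 G' / 2\<close>. The horizontal part of their cross product is \<open>(c, - G c)\<close>, hence the
  horizontal perimeter is \<open>\<surd>(1 + G\<^sup>2) (1 + y\<^sup>2 G' / 2) dy dt\<close>.
  With \<open>s = y \<surd>(1 + G\<^sup>2)\<close> and \<open>k = G' / (2 (1 + G\<^sup>2))\<close> the perimeter becomes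
  \<open>(1 + s\<^sup>2 k(t)) ds dt\<close>, and the gauge ball of radius \<open>r\<close> about \<open>(0, 0, t\<^sub>0)\<close> becomes
  \<open>s\<^sup>4 + 16 (t - t\<^sub>0)\<^sup>2 < r\<^sup>4\<close>, the same set for every \<open>G\<close>.

  The flat part \<open>ds dt\<close> scales under \<open>(s, t - t\<^sub>0) \<mapsto> (r s, r\<^sup>2 (t - t\<^sub>0))\<close> exactly like \<open>r\<^sup>3\<close>
  and contributes a positive constant to the quotient. In the other part only \<open>s\<close> is
  scaled: the factor \<open>s\<^sup>2 ds\<close> produces \<open>r\<^sup>3\<close>, and what remains is the integral of
  \<open>s\<^sup>2 k(t) \<ge> 0\<close> over \<open>s\<^sup>4 + 16 (t - t\<^sub>0)\<^sup>2 / r\<^sup>4 < 1\<close>, a region that grows with \<open>r\<close>. This is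
  \<open>nn_integral_strip_scaling\<close>; both claims of the theorem are read off from it.

  Before this computation the perimeter measure has to be brought into coordinates. Both the
  surface measure and the unit normal are obtained by an arbitrary choice, so
  \<open>emeasure_sigma_H\<close> shows that a surface with one good global parametrization has the expected
  perimeter integral in that parametrization, whatever was chosen. The normal is determined up to
  sign because the tangent vectors span the tangent plane even at boundary points
  (\<open>riem_normal_tangent_iff\<close>), and any two parametrizations differ by a change of variables
  (\<open>nn_integral_parametrization_eq\<close>).
\<close>

section \<open>Change of variables for nonnegative functions\<close>

lemma nn_integral_eq_ennreal_iff_has_integral:
  fixes f :: "'a::euclidean_space \<Rightarrow> real"
  assumes S: "S \<in> sets lebesgue" and f: "f \<in> borel_measurable (lebesgue_on S)"
    and nonneg: "\<And>x. x \<in> S \<Longrightarrow> 0 \<le> f x"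
  shows "(\<integral>\<^sup>+x. ennreal (f x) \<partial>lebesgue_on S) = ennreal r \<and> 0 \<le> r \<longleftrightarrow> (f has_integral r) S"
proof -
  let ?f = "\<lambda>x. if x \<in> S then f x else 0"
  have meas: "?f \<in> borel_measurable lebesgue"
    using f S by (simp add: borel_measurable_if)
  have "(\<integral>\<^sup>+x. ennreal (f x) \<partial>lebesgue_on S) = (\<integral>\<^sup>+x. ennreal (f x) * indicator S x \<partial>lebesgue)"
    using S by (subst nn_integral_restrict_space) auto
  also have "\<dots> = (\<integral>\<^sup>+x. ennreal (?f x) \<partial>lebesgue)"
    by (intro nn_integral_cong) (auto simp: indicator_def)
  finally show ?thesis
    using has_integral_iff_nn_integral_lebesgue[of ?f r] nonneg meas
    by (auto simp: has_integral_restrict_UNIV)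
qed

text \<open>The library theorem is about absolute integrability and the value of the integral. For a
  nonnegative function it decides all finite values of the integral, and hence also the value
  \<open>\<infinity>\<close>.\<close>

lemma nn_integral_change_of_variables:
  fixes f :: "real^'m::{finite,wellorder} \<Rightarrow> real" and g :: "real^'m::_ \<Rightarrow> real^'m::_"
  assumes S: "S \<in> sets lebesgue"
    and der: "\<And>x. x \<in> S \<Longrightarrow> (g has_derivative g' x) (at x within S)"
    and inj: "inj_on g S"
    and nonneg: "\<And>y. y \<in> g ` S \<Longrightarrow> 0 \<le> f y"
    and meas_f: "f \<in> borel_measurable (lebesgue_on (g ` S))"
    and meas_fg: "(\<lambda>x. f (g x)) \<in> borel_measurable (lebesgue_on S)"
  shows "(\<integral>\<^sup>+x. ennreal (\<bar>det (matrix (g' x))\<bar> * f (g x)) \<partial>lebesgue_on S)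
           = (\<integral>\<^sup>+y. ennreal (f y) \<partial>lebesgue_on (g ` S))"
    (is "?L = ?R")
proof -
  let ?h = "\<lambda>x. \<bar>det (matrix (g' x))\<bar> * f (g x)"
  have meas_h: "?h \<in> borel_measurable (lebesgue_on S)"
    using borel_measurable_det_Jacobian[OF S der] meas_fg by measurable
  have gS: "g ` S \<in> sets lebesgue"
    using S der by (intro differentiable_image_in_sets_lebesgue)
      (auto simp: differentiable_on_def differentiable_def)
  \<comment> \<open>Real functions are passed to the vector-valued theorem as functions into \<open>real^1\<close>.\<close>
  have vec_h: "(\<lambda>x. \<bar>det (matrix (g' x))\<bar> *\<^sub>R (vec (f (g x)) :: real^1)) = (\<lambda>x. vec (?h x))"
    by (auto simp: vec_eq_iff)
  have hi: "(?h has_integral b) S \<longleftrightarrow> (f has_integral b) (g ` S)" for b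
  proof -
    have "?h absolutely_integrable_on S \<and> integral S ?h = b
            \<longleftrightarrow> f absolutely_integrable_on (g ` S) \<and> integral (g ` S) f = b"
      using has_absolute_integral_change_of_variables[OF S der inj, where f="\<lambda>y. vec (f y) :: real^1" and b="vec b"]
      by (simp add: vec_h absolutely_integrable_on_1_iff integral_on_1_eq vec_eq_iff)
    moreover have "?h absolutely_integrable_on S \<longleftrightarrow> ?h integrable_on S"
      using nonneg by (intro absolutely_integrable_on_iff_nonneg) auto
    moreover have "f absolutely_integrable_on (g ` S) \<longleftrightarrow> f integrable_on (g ` S)"
      using nonneg by (intro absolutely_integrable_on_iff_nonneg) auto
    ultimately show ?thesis
      by (simp add: has_integral_iff)
  qed
  have eq: "?L = ennreal r \<and> 0 \<le> r \<longleftrightarrow> ?R = ennreal r \<and> 0 \<le> r" for r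
    using nn_integral_eq_ennreal_iff_has_integral[OF S meas_h, of r]
      nn_integral_eq_ennreal_iff_has_integral[OF gS meas_f, of r] nonneg hi[of r]
    by auto
  show ?thesis
  proof (cases ?L)
    case (real r)
    then show ?thesis using eq[of r] by auto
  next
    case top
    then show ?thesis using eq by (cases ?R) auto
  qed
qed

section \<open>Area and horizontal area in the orthonormal frame\<close>

lemma frame_coords_altdef:
  "frame_coords p v =
     (fst v, fst (snd v), snd (snd v) + (fst (snd p) * fst v - fst p * fst (snd v)) / 2)"
  by (cases p; cases v) auto

lemma linear_frame_coords: "linear (frame_coords p)"
  by (rule linearI) (auto simp: frame_coords_altdef field_simps add_divide_distrib)

fun cross :: "heis \<Rightarrow> heis \<Rightarrow> heis" where
  "cross (a1, a2, a3) (b1, b2, b3) = (a2 * b3 - a3 * b2, a3 * b1 - a1 * b3, a1 * b2 - a2 * b1)"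

lemma cross_altdef:
  "cross a b = (fst (snd a) * snd (snd b) - snd (snd a) * fst (snd b),
     snd (snd a) * fst b - fst a * snd (snd b), fst a * fst (snd b) - fst (snd a) * fst b)"
  by (cases a; cases b) auto

text \<open>The cross product of the two coordinate tangent vectors, in frame coordinates. Its norm is the
  Riemannian area element and the norm of its first two entries is the density of the
  horizontal perimeter.\<close>

definition normal :: "heis \<Rightarrow> (real^2 \<Rightarrow> heis) \<Rightarrow> heis" where
  "normal p A = cross (frame_coords p (A (axis 1 1))) (frame_coords p (A (axis 2 1)))"

definition horizontal_norm :: "heis \<Rightarrow> real" where
  "horizontal_norm n = sqrt ((fst n)\<^sup>2 + (fst (snd n))\<^sup>2)"

text \<open>Lagrange's identity for the Gram determinant.\<close>

lemma area_element_eq_norm_normal: "area_element p A = norm (normal p A)"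
proof -
  obtain a1 a2 a3 where a: "frame_coords p (A (axis 1 1)) = (a1, a2, a3)"
    by (cases "frame_coords p (A (axis 1 1))")
  obtain b1 b2 b3 where b: "frame_coords p (A (axis 2 1)) = (b1, b2, b3)"
    by (cases "frame_coords p (A (axis 2 1))")
  have "(a1 * a1 + a2 * a2 + a3 * a3) * (b1 * b1 + b2 * b2 + b3 * b3) - (a1 * b1 + a2 * b2 + a3 * b3)\<^sup>2
      = (a2 * b3 - a3 * b2)\<^sup>2 + (a3 * b1 - a1 * b3)\<^sup>2 + (a1 * b2 - a2 * b1)\<^sup>2"
    by algebra
  then show ?thesis
    by (simp add: area_element_def normal_def Let_def riem_def a b norm_Pair add.assoc)
qed

lemma real2_decomp: "(v::real^2) = (v $ 1) *\<^sub>R axis 1 1 + (v $ 2) *\<^sub>R axis 2 1"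
  by (simp add: vec_eq_iff forall_2 axis_def)

lemma linear_real2:
  assumes "linear A"
  shows "A (v::real^2) = (v $ 1) *\<^sub>R A (axis 1 1) + (v $ 2) *\<^sub>R A (axis 2 1)"
proof -
  have "A v = A ((v $ 1) *\<^sub>R axis 1 1 + (v $ 2) *\<^sub>R axis 2 1)"
    using real2_decomp[of v] by simp
  also have "\<dots> = (v $ 1) *\<^sub>R A (axis 1 1) + (v $ 2) *\<^sub>R A (axis 2 1)"
    using assms by (simp add: linear_add linear_scale)
  finally show ?thesis .
qed

text \<open>This is how the area element changes with the parametrization.\<close>

lemma normal_comp:
  assumes A: "linear A"
  shows "normal p (A \<circ> M) = det (matrix M) *\<^sub>R normal p A"
proof -
  have lin: "linear (frame_coords p \<circ> A)"
    using A linear_frame_coords by (rule linear_compose)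
  show ?thesis
    using linear_real2[OF lin, of "M (axis 1 1)"] linear_real2[OF lin, of "M (axis 2 1)"]
    by (auto simp: normal_def det_2 matrix_def cross_altdef algebra_simps)
qed

lemma frame_coords_eq_0_iff: "frame_coords p v = 0 \<longleftrightarrow> v = 0"
  by (cases p; cases v) (auto simp: zero_prod_def)

lemma normal_nonzero:
  assumes A: "linear A" "inj A"
  shows "normal p A \<noteq> 0"
proof
  assume 0: "normal p A = 0"
  define B where "B = frame_coords p \<circ> A"
  have B: "linear B"
    unfolding B_def using A(1) linear_frame_coords by (rule linear_compose)
  have zero: "e = 0" if "B e = 0" for e
    using that A by (simp add: B_def frame_coords_eq_0_iff linear_injective_0)
  let ?a = "B (axis 1 1)" and ?b = "B (axis 2 1)"
  obtain a1 a2 a3 where a: "?a = (a1, a2, a3)" by (cases ?a)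
  obtain b1 b2 b3 where b: "?b = (b1, b2, b3)" by (cases ?b)
  have c: "a2 * b3 - a3 * b2 = 0" "a3 * b1 - a1 * b3 = 0" "a1 * b2 - a2 * b1 = 0"
    using 0 a b by (simp_all add: normal_def B_def zero_prod_def)
  \<comment> \<open>\<open>(a \<bullet> b) a - (a \<bullet> a) b = a \<times> (a \<times> b) = 0\<close>\<close>
  define e :: "real^2" where "e = vector [?a \<bullet> ?b, - (?a \<bullet> ?a)]"
  have "B e = (?a \<bullet> ?b) *\<^sub>R ?a - (?a \<bullet> ?a) *\<^sub>R ?b"
    using linear_real2[OF B, of e] by (simp add: e_def)
  also have "\<dots> = 0"
    using c unfolding a b by (simp add: zero_prod_def) algebra
  finally have "e = 0" by (rule zero)
  then have "e $ 2 = 0" by simp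
  then have "?a = 0" by (simp add: e_def)
  then have "axis 1 1 = (0::real^2)" by (rule zero)
  then show False by simp
qed

text \<open>A unit vector orthogonal to \<open>a\<close> and \<open>b\<close> is parallel to \<open>a \<times> b\<close>. In particular the area element times \<open>W\<close> is the horizontal norm of the cross product, for
  either choice of the sign of the unit normal.\<close>

lemma horizontal_norm_eq_orthogonal:
  assumes "\<nu> \<bullet> a = 0" "\<nu> \<bullet> b = 0" "norm \<nu> = 1"
  shows "horizontal_norm \<nu> * norm (cross a b) = horizontal_norm (cross a b)"
proof -
  obtain a1 a2 a3 where a: "a = (a1,a2,a3)" by (cases a)
  obtain b1 b2 b3 where b: "b = (b1,b2,b3)" by (cases b)
  obtain u1 u2 u3 where u: "\<nu> = (u1,u2,u3)" by (cases \<nu>)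
  obtain n1 n2 n3 where n: "cross a b = (n1,n2,n3)" by (cases "cross a b")
  have orth: "u1*a1+u2*a2+u3*a3 = 0" "u1*b1+u2*b2+u3*b3 = 0"
    using assms by (auto simp: a b u)
  have one: "u1\<^sup>2+u2\<^sup>2+u3\<^sup>2 = 1"
    using assms(3) by (simp add: u norm_Pair)
  have n': "n1 = a2 * b3 - a3 * b2" "n2 = a3 * b1 - a1 * b3" "n3 = a1 * b2 - a2 * b1"
    using n by (auto simp: a b)
  \<comment> \<open>\<open>\<nu> \<times> (a \<times> b) = a (\<nu> \<bullet> b) - b (\<nu> \<bullet> a) = 0\<close>\<close>
  have par: "u1 * n3 = u3 * n1" "u2 * n3 = u3 * n2"
    using orth unfolding n' by algebra+
  have "(u1\<^sup>2+u2\<^sup>2) * (n1\<^sup>2+n2\<^sup>2+n3\<^sup>2) = (n1\<^sup>2+n2\<^sup>2) * (u1\<^sup>2+u2\<^sup>2+u3\<^sup>2)"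
    using par by algebra
  then show ?thesis
    by (simp add: horizontal_norm_def n u norm_Pair one flip: real_sqrt_mult)
       (simp add: add.assoc)
qed

section \<open>The unit normal of a parametrised surface\<close>

lemma frame_coords_X: "frame_coords p (X1 p) = (1, 0, 0)" "frame_coords p (X2 p) = (0, 1, 0)"
  by (cases p; simp)+

text \<open>A surface with a global parametrization \<open>\<psi>\<close> whose inverse extends to a differentiable map
  \<open>\<pi>\<close> of the ambient space. Composing \<open>\<pi>\<close> with an arbitrary parametrization or with a curve in
  the surface then gives a differentiable map into the parameters, without the implicit function
  theorem. The parameter domain may contain boundary points, where convexity and
  nonempty interior guarantee that the differential is still determined.\<close>

locale surface_chart =
  fixes V :: "(real^2) set" and \<psi> :: "real^2 \<Rightarrow> heis" and E :: "real^2 \<Rightarrow> real^2 \<Rightarrow> heis"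
    and S :: "heis set" and \<pi> :: "heis \<Rightarrow> real^2" and L :: "heis \<Rightarrow> heis \<Rightarrow> real^2"
  assumes convex: "convex V" and interior: "interior V \<noteq> {}"
    and param: "C1_parametrization V \<psi> E S"
    and chart: "\<And>v. v \<in> V \<Longrightarrow> \<pi> (\<psi> v) = v"
    and der_chart: "\<And>p. (\<pi> has_derivative L p) (at p)"
begin

lemma der_param: "v \<in> V \<Longrightarrow> (\<psi> has_derivative E v) (at v within V)"
  and inj_deriv: "v \<in> V \<Longrightarrow> inj (E v)"
  and cont_deriv: "continuous_on V (\<lambda>v. E v e)"
  and param_in: "v \<in> V \<Longrightarrow> \<psi> v \<in> S"
  and image_param: "\<psi> ` V = S"
  using param by (auto simp: C1_parametrization_def bij_betw_def)

lemma linear_deriv: "v \<in> V \<Longrightarrow> linear (E v)"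
  using der_param has_derivative_linear by blast

lemma chart_in: "p \<in> S \<Longrightarrow> \<pi> p \<in> V"
  and param_chart: "p \<in> S \<Longrightarrow> \<psi> (\<pi> p) = p"
  using image_param chart by auto

lemma continuous_chart: "continuous_on A \<pi>"
  using der_chart by (meson continuous_at_imp_continuous_on has_derivative_continuous)

text \<open>A curve \<open>\<gamma>\<close> in the surface equals \<open>\<psi> \<circ> (\<pi> \<circ> \<gamma>)\<close>, so the chain rule applies.\<close>

lemma tangent_vectors_le:
  assumes v: "v \<in> V" and w: "w \<in> tangent_vectors S (\<psi> v)"
  shows "\<exists>e. w = E v e"
proof -
  obtain \<gamma> where \<gamma>: "\<gamma> 0 = \<psi> v" "\<gamma> ` {0..1} \<subseteq> S"
    and der: "(\<gamma> has_vector_derivative w) (at (0::real) within {0..1})"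
    using w by (auto simp: tangent_vectors_def)
  have "((\<pi> \<circ> \<gamma>) has_derivative L (\<gamma> 0) \<circ> (\<lambda>s. s *\<^sub>R w)) (at 0 within {0..1})"
    using der has_derivative_at_withinI[OF der_chart]
    unfolding has_vector_derivative_def by (rule diff_chain_within)
  moreover have "(\<psi> has_derivative E v) (at ((\<pi> \<circ> \<gamma>) 0) within (\<pi> \<circ> \<gamma>) ` {0..1})"
  proof (rule has_derivative_subset)
    show "(\<psi> has_derivative E v) (at ((\<pi> \<circ> \<gamma>) 0) within V)"
      using der_param v by (simp add: \<gamma> chart)
    show "(\<pi> \<circ> \<gamma>) ` {0..1} \<subseteq> V"
      using \<gamma>(2) by (auto simp: image_subset_iff chart_in)
  qed
  ultimately have "((\<psi> \<circ> (\<pi> \<circ> \<gamma>)) has_derivative E v \<circ> (L (\<gamma> 0) \<circ> (\<lambda>s. s *\<^sub>R w)))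
                     (at 0 within {0..1})"
    by (rule diff_chain_within)
  then have "(\<gamma> has_derivative E v \<circ> (L (\<gamma> 0) \<circ> (\<lambda>s. s *\<^sub>R w))) (at 0 within {0..1})"
    by (rule has_derivative_transform_within[of _ _ _ _ 1]) (use \<gamma>(2) in \<open>auto simp: image_subset_iff param_chart\<close>)
  moreover have "E v \<circ> (L (\<gamma> 0) \<circ> (\<lambda>s. s *\<^sub>R w)) = (\<lambda>s. s *\<^sub>R E v (L (\<gamma> 0) w))"
    using linear_deriv[OF v] has_derivative_linear[OF der_chart, of "\<gamma> 0"]
    by (auto simp: linear_scale fun_eq_iff)
  ultimately have "(\<gamma> has_vector_derivative E v (L (\<gamma> 0) w)) (at 0 within {0..1})"
    by (simp add: has_vector_derivative_def)
  then have "w = E v (L (\<gamma> 0) w)"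
    using vector_derivative_unique_within_closed_interval[of 0 1 0 \<gamma>] der by simp
  then show ?thesis by blast
qed

text \<open>The segment from \<open>v\<close> to \<open>w\<close> stays in the convex parameter domain; its image under \<open>\<psi>\<close> is the
  required curve.\<close>

lemma tangent_vectors_ge:
  assumes v: "v \<in> V" and w: "w \<in> V"
  shows "E v (w - v) \<in> tangent_vectors S (\<psi> v)"
proof -
  let ?l = "\<lambda>s. v + s *\<^sub>R (w - v)"
  have l: "?l ` {0..1} \<subseteq> V"
    using convex v w by (auto simp: convex_alt algebra_simps)
  have "(?l has_derivative (\<lambda>s. s *\<^sub>R (w - v))) (at 0 within {0..1})"
    by (auto intro!: derivative_eq_intros)
  moreover have "(\<psi> has_derivative E v) (at (?l 0) within ?l ` {0..1})"
    using der_param[OF v] l has_derivative_subset by auto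
  ultimately have "((\<psi> \<circ> ?l) has_derivative E v \<circ> (\<lambda>s. s *\<^sub>R (w - v))) (at 0 within {0..1})"
    by (rule diff_chain_within)
  then have "((\<psi> \<circ> ?l) has_vector_derivative E v (w - v)) (at 0 within {0..1})"
    using linear_deriv[OF v] by (simp add: has_vector_derivative_def o_def linear_scale)
  then show ?thesis
    using l param_in unfolding tangent_vectors_def
    by (auto intro!: exI[of _ "\<psi> \<circ> ?l"])
qed

text \<open>At a boundary point the tangent vectors form only a cone, but it contains the images of all
  \<open>w - v\<close> with \<open>w\<close> in some ball. Differences of such vectors fill a ball around \<open>0\<close> in the
  parameter plane, so orthogonality to the cone is orthogonality to the whole plane.\<close>

lemma riem_normal_tangent_iff:
  assumes v: "v \<in> V"
  shows "(\<forall>w\<in>tangent_vectors S (\<psi> v). riem (\<psi> v) \<nu> w = 0) \<longleftrightarrow> (\<forall>e. riem (\<psi> v) \<nu> (E v e) = 0)"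
    (is "?l \<longleftrightarrow> ?r")
proof
  assume ?r
  then show ?l using tangent_vectors_le[OF v] by blast
next
  assume l: ?l
  define f where "f e = riem (\<psi> v) \<nu> (E v e)" for e
  have f: "linear f"
    using linear_deriv[OF v] linear_frame_coords
    unfolding f_def riem_def
    by (intro linearI) (simp_all add: linear_add linear_scale inner_add_right)
  have f0: "f (w - v) = 0" if "w \<in> V" for w
    using l tangent_vectors_ge[OF v that] by (simp add: f_def)
  obtain c r where r: "r > 0" "ball c r \<subseteq> V"
    using interior by (metis all_not_in_conv mem_interior)
  have "f e = 0" for e
  proof (cases "e = 0")
    case False
    define k where "k = r / (2 * norm e)"
    have k: "k > 0" using False r by (simp add: k_def)
    have "c + k *\<^sub>R e \<in> V" "c \<in> V"
      using r False by (auto simp: dist_norm k_def)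
    then have "f ((c + k *\<^sub>R e) - v) - f (c - v) = 0"
      using f0 by simp
    moreover have "f ((c + k *\<^sub>R e) - v) - f (c - v) = k * f e"
      using f by (simp add: linear_diff linear_add linear_scale)
    ultimately show ?thesis using k by simp
  qed (simp add: f linear_0)
  then show ?r by (simp add: f_def)
qed

lemma normal_chart_nonzero: "v \<in> V \<Longrightarrow> normal (\<psi> v) (E v) \<noteq> 0"
  using linear_deriv inj_deriv by (rule normal_nonzero)

text \<open>The chosen unit normal has the defining property because some vector has it, namely the
  normalised cross product; by \<open>horizontal_norm_eq_orthogonal\<close> every such vector gives the same
  value of \<open>W\<close>.\<close>

lemma W_param:
  assumes v: "v \<in> V"
  shows "W S (\<psi> v) = horizontal_norm (normal (\<psi> v) (E v)) / norm (normal (\<psi> v) (E v))"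
proof -
  let ?p = "\<psi> v"
  let ?n = "normal ?p (E v)"
  define \<nu> where "\<nu> = unit_normal S ?p"
  define b where "b = frame_coords ?p"
  have cross_orth: "cross x y \<bullet> x = 0" "cross x y \<bullet> y = 0" for x y
    by (cases x; cases y; simp add: algebra_simps)+
  obtain \<mu> where \<mu>: "frame_coords ?p \<mu> = ?n /\<^sub>R norm ?n"
  proof -
    obtain n1 n2 n3 where n: "?n /\<^sub>R norm ?n = (n1, n2, n3)"
      by (cases "?n /\<^sub>R norm ?n")
    obtain x y t where p: "?p = (x, y, t)" by (cases ?p)
    have "frame_coords ?p (n1, n2, n3 - (y * n1 - x * n2) / 2) = (n1, n2, n3)"
      by (simp add: p)
    then show ?thesis using n that by metis
  qed
  have "riem ?p \<mu> \<mu> = 1"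
    using normal_chart_nonzero[OF v] by (simp add: riem_def \<mu> dot_square_norm power2_eq_square)
  moreover have "riem ?p \<mu> (E v e) = 0" for e
  proof -
    have lin: "linear (\<lambda>e. frame_coords ?p (E v e))"
      using linear_compose[OF linear_deriv[OF v] linear_frame_coords] by (simp add: o_def)
    show ?thesis
      unfolding riem_def linear_real2[OF lin, of e]
      by (simp add: \<mu> normal_def inner_add_right cross_orth)
  qed
  ultimately have "\<exists>\<nu>. riem ?p \<nu> \<nu> = 1 \<and> (\<forall>w\<in>tangent_vectors S ?p. riem ?p \<nu> w = 0)"
    using riem_normal_tangent_iff[OF v] by blast
  then have "riem ?p \<nu> \<nu> = 1 \<and> (\<forall>w\<in>tangent_vectors S ?p. riem ?p \<nu> w = 0)"
    unfolding \<nu>_def unit_normal_def by (rule someI_ex)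
  then have \<nu>: "norm (b \<nu>) = 1" "\<And>e. b \<nu> \<bullet> b (E v e) = 0"
    using riem_normal_tangent_iff[OF v] by (auto simp: riem_def b_def norm_eq_1)
  have b: "frame_coords ?p = b"
    by (simp add: b_def)
  have X: "b (X1 ?p) = (1, 0, 0)" "b (X2 ?p) = (0, 1, 0)"
    by (simp_all add: b_def frame_coords_X)
  have "W S ?p = horizontal_norm (b \<nu>)"
    by (cases "b \<nu>") (simp add: W_def horizontal_norm_def \<nu>_def[symmetric] riem_def b X)
  moreover have "horizontal_norm (b \<nu>) * norm ?n = horizontal_norm ?n"
    unfolding normal_def using \<nu> by (intro horizontal_norm_eq_orthogonal) (auto simp: b_def)
  ultimately show ?thesis
    using normal_chart_nonzero[OF v] by (simp add: field_simps)
qed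

end

section \<open>The perimeter as an integral over the parameters\<close>

lemma continuous_on_normal:
  assumes "continuous_on U \<phi>" "\<And>e. continuous_on U (\<lambda>u. D u e)"
  shows "continuous_on U (\<lambda>u. normal (\<phi> u) (D u))"
  unfolding normal_def cross_altdef frame_coords_altdef
  using assms by (auto intro!: continuous_intros)

lemma continuous_on_horizontal_norm [continuous_intros]:
  "continuous_on U f \<Longrightarrow> continuous_on U (\<lambda>u. horizontal_norm (f u))"
  unfolding horizontal_norm_def by (intro continuous_intros)

lemma sets_lebesgue_negligible_frontier:
  assumes "negligible (frontier U)"
  shows "U \<in> sets lebesgue"
proof -
  have "U = interior U \<union> (U \<inter> frontier U)"
    using interior_subset closure_subset by (auto simp: frontier_def)
  moreover have "negligible (U \<inter> frontier U)"
    using assms by (rule negligible_subset) auto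
  ultimately show ?thesis
    by (metis borel_open negligible_imp_sets open_interior sets.Un sets_completionI_sets sets_lborel)
qed

context surface_chart
begin

lemma continuous_param: "continuous_on V \<psi>"
  using der_param has_derivative_continuous_on by blast

definition perimeter_density :: "real^2 \<Rightarrow> real" where
  "perimeter_density v = horizontal_norm (normal (\<psi> v) (E v))"

lemma perimeter_density_nonneg: "0 \<le> perimeter_density v"
  by (simp add: perimeter_density_def horizontal_norm_def)

lemma continuous_perimeter_density: "continuous_on V perimeter_density"
  unfolding perimeter_density_def
  by (intro continuous_intros continuous_on_normal continuous_param cont_deriv)

text \<open>The measure with density \<open>W\<close> is an integral of \<open>W\<close> only if \<open>W\<close> is measurable. Expressed
  through the chart, \<open>W\<close> is even continuous on \<open>S\<close>.\<close>

lemma measurable_W: "W S \<in> borel_measurable (restrict_space borel S)"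
proof (rule borel_measurable_continuous_on_restrict)
  let ?n = "\<lambda>v. normal (\<psi> v) (E v)"
  have "continuous_on V (\<lambda>v. perimeter_density v / norm (?n v))"
    using normal_chart_nonzero
    by (intro continuous_intros continuous_on_normal continuous_param cont_deriv
        continuous_perimeter_density) auto
  then have "continuous_on S (\<lambda>p. perimeter_density (\<pi> p) / norm (?n (\<pi> p)))"
    by (rule continuous_on_compose2) (auto intro: continuous_chart chart_in)
  moreover have "perimeter_density (\<pi> p) / norm (?n (\<pi> p)) = W S p" if "p \<in> S" for p
    using W_param[OF chart_in[OF that]] by (simp add: param_chart that perimeter_density_def)
  ultimately show "continuous_on S (W S)"
    by (simp cong: continuous_on_cong)
qed

text \<open>With the transition map \<open>h = \<pi> \<circ> \<phi>\<close> one has \<open>\<phi> = \<psi> \<circ> h\<close>, so the area element of \<open>\<phi>\<close> is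
  \<open>\<bar>det h'\<bar>\<close> times that of \<open>\<psi>\<close>, and the change of variables formula for \<open>h\<close> applies. The chain
  rule identifies \<open>D u\<close> at interior points of \<open>U\<close>, which are almost all points of \<open>U\<close>; at other
  points of an arbitrary set the differential within the set need not be unique.\<close>

lemma nn_integral_parametrization_eq:
  assumes par: "C1_parametrization U \<phi> D S" and A: "A \<in> sets borel"
  shows "(\<integral>\<^sup>+u. ennreal (area_element (\<phi> u) (D u)) * (ennreal (W S (\<phi> u)) * indicator A (\<phi> u)) \<partial>lebesgue_on U)
      = (\<integral>\<^sup>+v. ennreal (perimeter_density v * indicator A (\<psi> v)) \<partial>lebesgue_on V)"
proof -
  have neg: "negligible (frontier U)" and \<phi>: "\<And>u. u \<in> U \<Longrightarrow> \<phi> u \<in> S" and img: "\<phi> ` U = S"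
    and inj: "inj_on \<phi> U"
    and der: "\<And>u. u \<in> U \<Longrightarrow> (\<phi> has_derivative D u) (at u within U)"
    and cont: "\<And>e. continuous_on U (\<lambda>u. D u e)"
    using par by (auto simp: C1_parametrization_def bij_betw_def)
  have U: "U \<in> sets lebesgue"
    using neg by (rule sets_lebesgue_negligible_frontier)
  have V: "V \<in> sets lebesgue"
    using param by (intro sets_lebesgue_negligible_frontier) (simp add: C1_parametrization_def)
  have cont\<phi>: "continuous_on U \<phi>"
    using der has_derivative_continuous_on by blast
  define h where "h = \<pi> \<circ> \<phi>"
  define h' where "h' u = L (\<phi> u) \<circ> D u" for u
  have hder: "(h has_derivative h' u) (at u within U)" if "u \<in> U" for u
    unfolding h_def h'_def using der[OF that] has_derivative_at_withinI[OF der_chart]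
    by (rule diff_chain_within)
  have hV: "h u \<in> V" and \<psi>h: "\<psi> (h u) = \<phi> u" if "u \<in> U" for u
    using \<phi>[OF that] chart_in param_chart by (auto simp: h_def)
  have himg: "h ` U = V"
  proof -
    have "h ` U = \<pi> ` (\<phi> ` U)" by (simp add: h_def image_comp)
    also have "\<dots> = \<pi> ` (\<psi> ` V)" by (simp only: img image_param)
    also have "\<dots> = V" using chart by (simp add: image_image)
    finally show ?thesis .
  qed
  have hinj: "inj_on h U"
  proof (rule inj_onI)
    fix u u' assume u: "u \<in> U" "u' \<in> U" "h u = h u'"
    then have "\<phi> u = \<phi> u'" using \<psi>h by metis
    then show "u = u'" using inj u by (simp add: inj_on_eq_iff)
  qed
  have chain: "D u = E (h u) \<circ> h' u" if u: "u \<in> interior U" for u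
  proof -
    have uU: "u \<in> U" using u interior_subset by blast
    have "(\<psi> has_derivative E (h u)) (at (h u) within h ` U)"
      using der_param[OF hV[OF uU]] by (simp only: himg)
    with hder[OF uU] have "((\<psi> \<circ> h) has_derivative E (h u) \<circ> h' u) (at u within U)"
      by (rule diff_chain_within)
    then have "(\<phi> has_derivative E (h u) \<circ> h' u) (at u within U)"
      by (rule has_derivative_transform[OF uU, rotated]) (simp add: \<psi>h)
    then have "(\<phi> has_derivative E (h u) \<circ> h' u) (at u)"
      by (simp only: at_within_interior[OF u])
    moreover have "(\<phi> has_derivative D u) (at u)"
      using der[OF uU] by (simp only: at_within_interior[OF u])
    ultimately show ?thesis
      using has_derivative_unique by blast
  qed
  let ?f = "\<lambda>v. perimeter_density v * indicator A (\<psi> v)"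
  have key: "ennreal (area_element (\<phi> u) (D u)) * (ennreal (W S (\<phi> u)) * indicator A (\<phi> u))
           = ennreal (\<bar>det (matrix (h' u))\<bar> * ?f (h u))" if u: "u \<in> interior U" for u
  proof -
    have uU: "u \<in> U" using u interior_subset by blast
    let ?n = "normal (\<psi> (h u)) (E (h u))"
    have "area_element (\<phi> u) (D u) = \<bar>det (matrix (h' u))\<bar> * norm ?n"
      using hV[OF uU] linear_deriv
      by (simp add: area_element_eq_norm_normal chain[OF u] normal_comp \<psi>h[OF uU, symmetric])
    moreover have "W S (\<phi> u) = perimeter_density (h u) / norm ?n"
      using W_param[OF hV[OF uU]] by (simp add: \<psi>h[OF uU] perimeter_density_def)
    ultimately have "area_element (\<phi> u) (D u) * W S (\<phi> u) = \<bar>det (matrix (h' u))\<bar> * perimeter_density (h u)"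
      using normal_chart_nonzero[OF hV[OF uU]] by simp
    moreover have "0 \<le> area_element (\<phi> u) (D u)"
      by (simp add: area_element_eq_norm_normal)
    ultimately show ?thesis
      by (auto simp: indicator_def \<psi>h[OF uU] simp flip: ennreal_mult')
  qed
  have ae: "AE u in lebesgue_on U. u \<in> interior U"
  proof -
    have "AE u in lebesgue. u \<notin> frontier U"
      using neg by (intro AE_not_in) (simp add: negligible_iff_null_sets)
    then have "AE u in lebesgue. u \<in> U \<longrightarrow> u \<in> interior U"
      by eventually_elim (use closure_subset in \<open>auto simp: frontier_def\<close>)
    then show ?thesis
      using U by (simp add: AE_restrict_space_iff)
  qed
  have hcont: "continuous_on U h"
    unfolding h_def by (intro continuous_on_compose cont\<phi> continuous_chart)
  have indA: "(\<lambda>u. indicator A (g u) :: real) \<in> borel_measurable (lebesgue_on X)"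
    if "continuous_on X g" "X \<in> sets lebesgue" for g :: "real^2 \<Rightarrow> heis" and X
    using continuous_imp_measurable_on_sets_lebesgue[OF that] borel_measurable_indicator[OF A]
    by (rule measurable_compose)
  have sub: "h ` U \<subseteq> V"
    by (simp add: himg)
  have "(\<lambda>u. indicator A (\<psi> (h u)) :: real) \<in> borel_measurable (lebesgue_on U)"
    using continuous_on_compose2[OF continuous_param hcont sub] U by (rule indA)
  moreover have "(\<lambda>u. perimeter_density (h u)) \<in> borel_measurable (lebesgue_on U)"
    using continuous_on_compose2[OF continuous_perimeter_density hcont sub] U
    by (rule continuous_imp_measurable_on_sets_lebesgue)
  ultimately have "(\<lambda>u. ?f (h u)) \<in> borel_measurable (lebesgue_on U)"
    by (rule borel_measurable_times[rotated])
  moreover have "?f \<in> borel_measurable (lebesgue_on V)"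
    using continuous_imp_measurable_on_sets_lebesgue[OF continuous_perimeter_density V]
      indA[OF continuous_param V] by (rule borel_measurable_times)
  ultimately have "(\<integral>\<^sup>+u. ennreal (\<bar>det (matrix (h' u))\<bar> * ?f (h u)) \<partial>lebesgue_on U)
       = (\<integral>\<^sup>+v. ennreal (?f v) \<partial>lebesgue_on V)"
    using nn_integral_change_of_variables[OF U hder hinj, of ?f] perimeter_density_nonneg
    by (simp add: himg)
  moreover have "(\<integral>\<^sup>+u. ennreal (area_element (\<phi> u) (D u)) * (ennreal (W S (\<phi> u)) * indicator A (\<phi> u)) \<partial>lebesgue_on U)
      = (\<integral>\<^sup>+u. ennreal (\<bar>det (matrix (h' u))\<bar> * ?f (h u)) \<partial>lebesgue_on U)"
    using ae by (intro nn_integral_cong_AE) (auto elim!: eventually_mono simp: key)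
  ultimately show ?thesis by simp
qed

lemma emeasure_sigma_H:
  assumes A: "A \<in> sets borel"
  shows "emeasure (sigma_H S) (S \<inter> A)
       = (\<integral>\<^sup>+v. ennreal (perimeter_density v * indicator A (\<psi> v)) \<partial>lebesgue_on V)"
proof -
  obtain U \<phi> D where some: "(SOME (U, \<phi>, D). C1_parametrization U \<phi> D S) = (U, \<phi>, D)"
    by (metis prod_cases3)
  have par: "C1_parametrization U \<phi> D S"
    using someI[of "\<lambda>(U, \<phi>, D). C1_parametrization U \<phi> D S" "(V, \<psi>, E)"] param some by auto
  let ?R = "restrict_space borel S"
  let ?a = "\<lambda>u. ennreal (area_element (\<phi> u) (D u))"
  let ?N = "density (lebesgue_on U) ?a"
  have M: "surface_measure S = distr ?N ?R \<phi>"
    by (simp add: surface_measure_def some)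
  have U: "U \<in> sets lebesgue"
    using par by (intro sets_lebesgue_negligible_frontier) (simp add: C1_parametrization_def)
  have cont\<phi>: "continuous_on U \<phi>" and \<phi>: "\<phi> \<in> U \<rightarrow> S"
    using par has_derivative_continuous_on[of U \<phi> D] by (auto simp: C1_parametrization_def bij_betw_def)
  have a: "?a \<in> borel_measurable (lebesgue_on U)"
    unfolding area_element_eq_norm_normal using par
    by (intro measurable_compose[OF _ measurable_ennreal] continuous_imp_measurable_on_sets_lebesgue U
        continuous_intros continuous_on_normal cont\<phi>) (auto simp: C1_parametrization_def)
  have \<phi>m: "\<phi> \<in> lebesgue_on U \<rightarrow>\<^sub>M ?R"
    using \<phi> by (intro measurable_restrict_space2 continuous_imp_measurable_on_sets_lebesgue cont\<phi> U) auto
  have SA: "S \<inter> A \<in> sets ?R"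
    using A by (auto simp: sets_restrict_space)
  have W: "(\<lambda>p. ennreal (W S p)) \<in> borel_measurable ?R"
    using measurable_W by measurable
  have WA: "(\<lambda>p. ennreal (W S p) * indicator (S \<inter> A) p) \<in> borel_measurable ?R"
    using W SA by (intro borel_measurable_times_ennreal borel_measurable_indicator)
  have "emeasure (sigma_H S) (S \<inter> A) = (\<integral>\<^sup>+p. ennreal (W S p) * indicator (S \<inter> A) p \<partial>distr ?N ?R \<phi>)"
    unfolding sigma_H_def M using W SA by (intro emeasure_density) auto
  also have "\<dots> = (\<integral>\<^sup>+u. ennreal (W S (\<phi> u)) * indicator (S \<inter> A) (\<phi> u) \<partial>?N)"
    using \<phi>m WA by (intro nn_integral_distr) (simp_all cong: measurable_cong_sets)
  also have "\<dots> = (\<integral>\<^sup>+u. ?a u * (ennreal (W S (\<phi> u)) * indicator (S \<inter> A) (\<phi> u)) \<partial>lebesgue_on U)"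
    using a by (rule nn_integral_density) (use measurable_compose[OF \<phi>m WA] in simp)
  also have "\<dots> = (\<integral>\<^sup>+u. ?a u * (ennreal (W S (\<phi> u)) * indicator A (\<phi> u)) \<partial>lebesgue_on U)"
    using \<phi> by (intro nn_integral_cong) (auto simp: indicator_def)
  also have "\<dots> = (\<integral>\<^sup>+v. ennreal (perimeter_density v * indicator A (\<psi> v)) \<partial>lebesgue_on V)"
    using par A by (rule nn_integral_parametrization_eq)
  finally show ?thesis .
qed

end

section \<open>Scaling of the perimeter integral of a strip\<close>

lemma nn_integral_lborel_real2:
  fixes f :: "real^2 \<Rightarrow> ennreal"
  assumes [measurable]: "f \<in> borel_measurable borel"
  shows "(\<integral>\<^sup>+v. f v \<partial>lborel) = (\<integral>\<^sup>+t. \<integral>\<^sup>+y. f (vector [y, t]) \<partial>lborel \<partial>lborel)"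
proof -
  let ?v = "\<lambda>(t::real, y::real). vector [y, t] :: real^2"
  have v: "?v = (\<lambda>x. snd x *\<^sub>R axis 1 1 + fst x *\<^sub>R axis 2 1)"
    by (auto simp: vec_eq_iff forall_2 axis_def)
  have [measurable]: "?v \<in> borel_measurable (lborel \<Otimes>\<^sub>M lborel)"
    unfolding v by measurable
  have "distr (lborel \<Otimes>\<^sub>M lborel) borel ?v = lborel"
  proof (rule lborel_eqI[symmetric])
    fix l u :: "real^2"
    assume le: "\<And>b. b \<in> Basis \<Longrightarrow> l \<bullet> b \<le> u \<bullet> b"
    have lu: "l $ i \<le> u $ i" for i
    proof -
      have "axis i (1::real) \<in> Basis" by (auto simp: Basis_vec_def)
      from le[OF this] show ?thesis by (simp add: inner_axis)
    qed
    have B: "(Basis :: (real^2) set) = {axis 1 1, axis 2 1}" "axis 1 1 \<noteq> (axis 2 1 :: real^2)"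
      by (auto simp: Basis_vec_def UNIV_2 axis_eq_axis)
    have "emeasure (distr (lborel \<Otimes>\<^sub>M lborel) borel ?v) (box l u)
        = emeasure (lborel \<Otimes>\<^sub>M lborel) ({l$2<..<u$2} \<times> {l$1<..<u$1})"
      by (subst emeasure_distr)
         (auto intro!: arg_cong[where f="emeasure _"] simp: space_pair_measure mem_box_cart forall_2)
    also have "\<dots> = ennreal (\<Prod>b\<in>Basis. (u - l) \<bullet> b)"
      using lu[of 1] lu[of 2]
      by (simp add: lborel.emeasure_pair_measure_Times B inner_axis ennreal_mult mult.commute)
    finally show "emeasure (distr (lborel \<Otimes>\<^sub>M lborel) borel ?v) (box l u) = ennreal (\<Prod>b\<in>Basis. (u - l) \<bullet> b)" .
  qed simp
  then have "(\<integral>\<^sup>+v. f v \<partial>lborel) = (\<integral>\<^sup>+v. f v \<partial>distr (lborel \<Otimes>\<^sub>M lborel) borel ?v)"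
    by simp
  also have "\<dots> = (\<integral>\<^sup>+x. f (?v x) \<partial>(lborel \<Otimes>\<^sub>M lborel))"
    by (intro nn_integral_distr) auto
  also have "\<dots> = (\<integral>\<^sup>+t. \<integral>\<^sup>+y. f (vector [y, t]) \<partial>lborel \<partial>lborel)"
    by (subst lborel.nn_integral_fst[symmetric]) auto
  finally show ?thesis .
qed

text \<open>The area of the section of the unit gauge ball by a vertical plane through its centre.\<close>

definition gauge_area :: ennreal where
  "gauge_area = (\<integral>\<^sup>+\<tau>. \<integral>\<^sup>+s. indicator {..<1} (s ^ 4 + 16 * \<tau>\<^sup>2) \<partial>lborel \<partial>(lborel :: real measure))"

text \<open>The rectangle \<open>\<bar>\<tau>\<bar> \<le> 1/8\<close>, \<open>\<bar>s\<bar> \<le> 1/2\<close> has area \<open>1/4\<close> and lies in the region, since there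
  \<open>s\<^sup>4 + 16 \<tau>\<^sup>2 \<le> 1/16 + 1/4\<close>.\<close>

lemma gauge_area_ge: "ennreal (1/4) \<le> gauge_area"
proof -
  have "ennreal (1/4) = (\<integral>\<^sup>+\<tau>. indicator {-1/8..1/8::real} \<tau> \<partial>lborel)"
    by simp
  also have "\<dots> = (\<integral>\<^sup>+\<tau>. \<integral>\<^sup>+s. indicator {-1/8..1/8::real} \<tau> * indicator {-1/2..1/2::real} s \<partial>lborel \<partial>lborel)"
    by (simp add: nn_integral_cmult)
  also have "\<dots> \<le> gauge_area"
    unfolding gauge_area_def
  proof (intro nn_integral_mono)
    fix \<tau> s :: real
    have "s ^ 4 + 16 * \<tau>\<^sup>2 < 1" if "\<bar>\<tau>\<bar> \<le> 1/8" "\<bar>s\<bar> \<le> 1/2"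
    proof -
      have "\<bar>s\<bar> ^ 4 \<le> (1/2) ^ 4" using that(2) by (intro power_mono) auto
      moreover have "\<bar>\<tau>\<bar>\<^sup>2 \<le> (1/8)\<^sup>2" using that(1) by (intro power_mono) auto
      ultimately show ?thesis by (simp add: power2_eq_square power4_eq_xxxx)
    qed
    then show "indicator {- 1/8..1/8} \<tau> * indicator {-1/2..1/2} s \<le> (indicator {..<1} (s ^ 4 + 16 * \<tau>\<^sup>2) :: ennreal)"
      by (auto simp: indicator_def abs_le_iff)
  qed
  finally show ?thesis .
qed

text \<open>What the bending of the strip adds to the perimeter in the ball of radius \<open>r\<close>, divided by
  \<open>r\<^sup>3\<close>. The coordinate \<open>s\<close> is already scaled by \<open>r\<close> whereas \<open>t\<close> is not, so that \<open>r\<close> occurs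
  only in the region of integration.\<close>

definition strip_excess :: "(real \<Rightarrow> real) \<Rightarrow> real \<Rightarrow> real \<Rightarrow> ennreal" where
  "strip_excess k t0 r = (\<integral>\<^sup>+t. \<integral>\<^sup>+s. ennreal (s\<^sup>2 * k t) * indicator {..<1} (s ^ 4 + 16 * (t - t0)\<^sup>2 / r ^ 4) \<partial>lborel \<partial>lborel)"

lemma strip_excess_mono:
  assumes "0 < r" "r \<le> r'"
  shows "strip_excess k t0 r \<le> strip_excess k t0 r'"
  unfolding strip_excess_def
proof (intro nn_integral_mono mult_left_mono)
  fix t s :: real
  have "16 * (t - t0)\<^sup>2 / r' ^ 4 \<le> 16 * (t - t0)\<^sup>2 / r ^ 4"
    using assms by (intro divide_left_mono power_mono mult_pos_pos) auto
  then show "indicator {..<1} (s ^ 4 + 16 * (t - t0)\<^sup>2 / r ^ 4)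
     \<le> (indicator {..<1} (s ^ 4 + 16 * (t - t0)\<^sup>2 / r' ^ 4) :: ennreal)"
    by (auto simp: indicator_def)
qed simp

lemma nn_integral_strip_scaling:
  fixes k :: "real \<Rightarrow> real"
  assumes k [measurable]: "k \<in> borel_measurable borel" and k0: "\<And>t. 0 \<le> k t" "\<And>t. t \<notin> I \<Longrightarrow> k t = 0"
    and r: "0 < r" "{t0 - r\<^sup>2 / 4 <..< t0 + r\<^sup>2 / 4} \<subseteq> I"
  shows "(\<integral>\<^sup>+t. \<integral>\<^sup>+s. indicator I t * ennreal (1 + s\<^sup>2 * k t) * indicator {..<r ^ 4} (s ^ 4 + 16 * (t - t0)\<^sup>2) \<partial>lborel \<partial>lborel)
       = ennreal (r ^ 3) * (gauge_area + strip_excess k t0 r)"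
proof -
  let ?B = "\<lambda>t s. indicator {..<r ^ 4} (s ^ 4 + 16 * (t - t0)\<^sup>2) :: ennreal"
  let ?b = "\<lambda>t s. indicator {..<1} (s ^ 4 + 16 * (t - t0)\<^sup>2 / r ^ 4) :: ennreal"
  have B: "?B t (r * s) = ?b t s" for t s
  proof -
    have "(r * s) ^ 4 + 16 * (t - t0)\<^sup>2 < r ^ 4 \<longleftrightarrow> s ^ 4 + 16 * (t - t0)\<^sup>2 / r ^ 4 < 1"
      using r(1) by (simp add: field_simps)
    then show ?thesis by (simp add: indicator_def)
  qed
  have tI: "t \<in> I" if "s ^ 4 + 16 * (t - t0)\<^sup>2 < r ^ 4" for s t
  proof -
    have "0 \<le> s ^ 4" by simp
    have "16 * (t - t0)\<^sup>2 < r ^ 4"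
      using that \<open>0 \<le> s ^ 4\<close> by linarith
    then have "(4 * \<bar>t - t0\<bar>)\<^sup>2 < (r\<^sup>2)\<^sup>2"
      by (simp add: power_mult_distrib)
    then have "4 * \<bar>t - t0\<bar> < r\<^sup>2"
      by (rule power2_less_imp_less) simp
    then show ?thesis using r(2) by (auto simp: subset_iff abs_if split: if_splits)
  qed
  \<comment> \<open>The region lies over \<open>I\<close> by \<open>tI\<close>, so the flat part does not see the ends of the strip.\<close>
  have split: "indicator I t * ennreal (1 + s\<^sup>2 * k t) * ?B t s = ?B t s + ennreal (s\<^sup>2 * k t) * ?B t s" for t s
    using k0(1)[of t] tI[of s t] by (auto simp: indicator_def ennreal_plus)
  \<comment> \<open>Scaling \<open>s\<close> gives a factor \<open>r\<close>, scaling \<open>t\<close> a factor \<open>r\<^sup>2\<close>.\<close>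
  have flat: "(\<integral>\<^sup>+t. \<integral>\<^sup>+s. ?B t s \<partial>lborel \<partial>lborel) = ennreal (r ^ 3) * gauge_area"
  proof -
    have "(\<integral>\<^sup>+t. \<integral>\<^sup>+s. ?B t s \<partial>lborel \<partial>lborel) = (\<integral>\<^sup>+t. ennreal r * (\<integral>\<^sup>+s. ?b t s \<partial>lborel) \<partial>lborel)"
      using r(1) by (subst nn_integral_real_affine[where c=r and t=0]) (auto simp: B)
    also have "\<dots> = ennreal r * (\<integral>\<^sup>+t. \<integral>\<^sup>+s. ?b t s \<partial>lborel \<partial>lborel)"
      by (intro nn_integral_cmult) measurable
    also have "(\<integral>\<^sup>+t. \<integral>\<^sup>+s. ?b t s \<partial>lborel \<partial>lborel)
        = ennreal (r\<^sup>2) * (\<integral>\<^sup>+\<tau>. \<integral>\<^sup>+s. ?b (t0 + r\<^sup>2 * \<tau>) s \<partial>lborel \<partial>lborel)"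
      using r(1) by (subst nn_integral_real_affine[where c="r\<^sup>2" and t=t0]) auto
    also have "(\<lambda>\<tau> s. ?b (t0 + r\<^sup>2 * \<tau>) s) = (\<lambda>\<tau> s. indicator {..<1} (s ^ 4 + 16 * \<tau>\<^sup>2))"
      using r(1) by (simp add: power_mult_distrib)
    finally have "(\<integral>\<^sup>+t. \<integral>\<^sup>+s. ?B t s \<partial>lborel \<partial>lborel) = ennreal r * (ennreal (r\<^sup>2) * gauge_area)"
      by (simp only: gauge_area_def)
    also have "\<dots> = ennreal (r ^ 3) * gauge_area"
      using r(1) by (simp add: mult.assoc[symmetric] ennreal_mult[symmetric] power2_eq_square power3_eq_cube)
    finally show ?thesis .
  qed
  \<comment> \<open>Scaling \<open>s\<close> gives a factor \<open>r\<close> from \<open>ds\<close> and \<open>r\<^sup>2\<close> from \<open>s\<^sup>2\<close>.\<close>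
  have curved: "(\<integral>\<^sup>+t. \<integral>\<^sup>+s. ennreal (s\<^sup>2 * k t) * ?B t s \<partial>lborel \<partial>lborel) = ennreal (r ^ 3) * strip_excess k t0 r"
  proof -
    have "(\<integral>\<^sup>+s. ennreal (s\<^sup>2 * k t) * ?B t s \<partial>lborel) = ennreal (r ^ 3) * (\<integral>\<^sup>+s. ennreal (s\<^sup>2 * k t) * ?b t s \<partial>lborel)" for t
    proof -
      have "(\<integral>\<^sup>+s. ennreal (s\<^sup>2 * k t) * ?B t s \<partial>lborel)
          = ennreal r * (\<integral>\<^sup>+s. ennreal ((r * s)\<^sup>2 * k t) * ?b t s \<partial>lborel)"
        using r(1) by (subst nn_integral_real_affine[where c=r and t=0]) (auto simp: B)
      also have "(\<lambda>s. ennreal ((r * s)\<^sup>2 * k t) * ?b t s) = (\<lambda>s. ennreal (r\<^sup>2) * (ennreal (s\<^sup>2 * k t) * ?b t s))"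
        using r(1) k0(1)[of t] by (simp add: power_mult_distrib mult.assoc ennreal_mult)
      also have "ennreal r * (\<integral>\<^sup>+s. ennreal (r\<^sup>2) * (ennreal (s\<^sup>2 * k t) * ?b t s) \<partial>lborel)
          = ennreal (r ^ 3) * (\<integral>\<^sup>+s. ennreal (s\<^sup>2 * k t) * ?b t s \<partial>lborel)"
        using r(1) by (subst nn_integral_cmult)
          (auto simp: mult.assoc[symmetric] ennreal_mult[symmetric] power2_eq_square power3_eq_cube)
      finally show ?thesis .
    qed
    then show ?thesis
      unfolding strip_excess_def by (simp add: nn_integral_cmult)
  qed
  have "(\<integral>\<^sup>+t. \<integral>\<^sup>+s. indicator I t * ennreal (1 + s\<^sup>2 * k t) * ?B t s \<partial>lborel \<partial>lborel)
      = (\<integral>\<^sup>+t. (\<integral>\<^sup>+s. ?B t s \<partial>lborel) + (\<integral>\<^sup>+s. ennreal (s\<^sup>2 * k t) * ?B t s \<partial>lborel) \<partial>lborel)"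
    unfolding split by (intro nn_integral_cong nn_integral_add) measurable
  also have "\<dots> = (\<integral>\<^sup>+t. \<integral>\<^sup>+s. ?B t s \<partial>lborel \<partial>lborel) + (\<integral>\<^sup>+t. \<integral>\<^sup>+s. ennreal (s\<^sup>2 * k t) * ?B t s \<partial>lborel \<partial>lborel)"
    by (intro nn_integral_add) measurable
  finally show ?thesis
    by (simp only: flat curved distrib_left)
qed

section \<open>Left translations and rotations\<close>

text \<open>The differential of the left translation by \<open>(x, y, t)\<close>. It is the same at every point because
  left translations are affine maps.\<close>

fun left_deriv :: "heis \<Rightarrow> heis \<Rightarrow> heis" where
  "left_deriv (x, y, t) (a, b, c) = (a, b, c + (x * b - a * y) / 2)"

lemma hmul_eq_affine: "hmul q p = q + left_deriv q p"
  by (cases q; cases p) simp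

lemma linear_left_deriv: "linear (left_deriv q)"
  by (cases q; rule linearI) (auto simp: field_simps)

lemma linear_rot: "linear (rot \<theta>)"
  by (rule linearI) (auto simp: algebra_simps)

lemma frame_coords_left_deriv: "frame_coords (hmul q p) (left_deriv q w) = frame_coords p w"
  by (cases q; cases p; cases w) (simp add: field_simps)

lemma frame_coords_rot: "frame_coords (rot \<theta> p) (rot \<theta> w) = rot \<theta> (frame_coords p w)"
proof -
  obtain x y t where p: "p = (x, y, t)" by (cases p)
  obtain a b c where w: "w = (a, b, c)" by (cases w)
  have "(x * sin \<theta> + y * cos \<theta>) * (a * cos \<theta> - b * sin \<theta>) - (x * cos \<theta> - y * sin \<theta>) * (a * sin \<theta> + b * cos \<theta>)
      = y * a - x * b"
    using sin_cos_squared_add[of \<theta>] by algebra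
  then show ?thesis by (simp add: p w)
qed

lemma cross_rot: "cross (rot \<theta> a) (rot \<theta> b) = rot \<theta> (cross a b)"
proof -
  obtain a1 a2 a3 where a: "a = (a1, a2, a3)" by (cases a)
  obtain b1 b2 b3 where b: "b = (b1, b2, b3)" by (cases b)
  have "(a1 * cos \<theta> - a2 * sin \<theta>) * (b1 * sin \<theta> + b2 * cos \<theta>) - (a1 * sin \<theta> + a2 * cos \<theta>) * (b1 * cos \<theta> - b2 * sin \<theta>)
      = a1 * b2 - a2 * b1"
    using sin_cos_squared_add[of \<theta>] by algebra
  then show ?thesis by (simp add: a b algebra_simps)
qed

lemma rot_sum_squares: "(x * cos \<theta> - y * sin \<theta>)\<^sup>2 + (x * sin \<theta> + y * cos \<theta>)\<^sup>2 = x\<^sup>2 + (y::real)\<^sup>2"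
  using sin_cos_squared_add[of \<theta>] by algebra

lemma horizontal_norm_rot: "horizontal_norm (rot \<theta> n) = horizontal_norm n"
  by (cases n) (simp add: horizontal_norm_def rot_sum_squares)

text \<open>Left translations are isometries that preserve the frame, and rotations about the \<open>t\<close>-axis
  rotate its horizontal part. The perimeter of a strip can therefore be computed in its
  normalised position.\<close>

lemma horizontal_norm_normal_invariant:
  "horizontal_norm (normal (hmul q (rot \<theta> p)) (\<lambda>e. left_deriv q (rot \<theta> (A e)))) = horizontal_norm (normal p A)"
  by (simp add: normal_def frame_coords_left_deriv frame_coords_rot cross_rot horizontal_norm_rot)

lemma rot_rot: "rot \<alpha> (rot \<beta> p) = rot (\<alpha> + \<beta>) p"
  by (cases p) (simp add: sin_add cos_add algebra_simps)

lemma rot_minus_rot: "rot (- \<theta>) (rot \<theta> p) = p"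
  unfolding rot_rot by (cases p) simp

text \<open>Hence only strips of the first kind need to be considered.\<close>

lemma strip_y_eq_rot: "strip_y I G = rot (- pi / 2) ` strip_x I G"
proof -
  have "rot (- pi / 2) (x, y, t) = (y, - x, t)" for x y t
    by simp
  then show ?thesis
    by (force simp: strip_y_def strip_x_def image_iff)
qed

lemma hmul_hinv_cancel: "hmul (hinv q) (hmul q p) = p"
  by (cases q; cases p) (simp add: field_simps)

lemma mem_gauge_ball_iff:
  assumes "0 < r"
  shows "hmul q (rot \<theta> (x, y, t)) \<in> gauge_ball (hmul q (0, 0, t0)) r
     \<longleftrightarrow> (x\<^sup>2 + y\<^sup>2)\<^sup>2 + 16 * (t - t0)\<^sup>2 < r ^ 4"
proof -
  have "hmul (hinv (hmul q (0, 0, t0))) (hmul q (rot \<theta> (x, y, t))) = rot \<theta> (x, y, t - t0)"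
    by (cases q) (simp add: field_simps)
  then have "hmul q (rot \<theta> (x, y, t)) \<in> gauge_ball (hmul q (0, 0, t0)) r
      \<longleftrightarrow> root 4 ((x\<^sup>2 + y\<^sup>2)\<^sup>2 + 16 * (t - t0)\<^sup>2) < root 4 (r ^ 4)"
    using assms by (simp add: gauge_ball_def gauge_def rot_sum_squares real_root_power_cancel)
  then show ?thesis by simp
qed

lemma borel_gauge_ball: "gauge_ball p r \<in> sets borel"
proof -
  have "continuous_on UNIV (hmul (hinv p))"
    unfolding hmul_eq_affine
    by (intro continuous_intros linear_continuous_on linear_conv_bounded_linear[THEN iffD1] linear_left_deriv)
  then have "continuous_on UNIV (\<lambda>x. gauge (hmul (hinv p) x))"
    unfolding gauge_def case_prod_beta by (intro continuous_intros) auto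
  then show ?thesis
    unfolding gauge_ball_def by (intro borel_open open_Collect_less continuous_intros)
qed

section \<open>The perimeter of a graphical strip\<close>

locale strip =
  fixes I :: "real set" and G G' :: "real \<Rightarrow> real"
  assumes interval: "is_interval I" and interior: "interior I \<noteq> {}"
    and deriv: "\<And>t. t \<in> I \<Longrightarrow> (G has_real_derivative G' t) (at t within I)"
    and cont_deriv: "continuous_on I G'"
    and deriv_nonneg: "\<And>t. t \<in> I \<Longrightarrow> 0 \<le> G' t"
begin

definition domain :: "(real^2) set" where
  "domain = {v. v $ 2 \<in> I}"

definition graph :: "real^2 \<Rightarrow> heis" where
  "graph v = (v $ 1 * G (v $ 2), v $ 1, v $ 2)"

definition graph_deriv :: "real^2 \<Rightarrow> real^2 \<Rightarrow> heis" where
  "graph_deriv v e = (e $ 1 * G (v $ 2) + v $ 1 * (G' (v $ 2) * e $ 2), e $ 1, e $ 2)"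

lemma cont_G: "continuous_on I G"
  using deriv has_field_derivative_imp_has_derivative has_derivative_continuous_on by (metis DERIV_continuous_on)

lemma der_graph:
  assumes v: "v \<in> domain"
  shows "(graph has_derivative graph_deriv v) (at v within domain)"
proof -
  have "((\<lambda>v. v $ 2) has_derivative (\<lambda>e. e $ 2)) (at v within domain)"
    by (intro bounded_linear_imp_has_derivative bounded_linear_vec_nth)
  moreover have "(G has_derivative (*) (G' (v $ 2))) (at (v $ 2) within (\<lambda>v. v $ 2) ` domain)"
    using deriv[of "v $ 2"] v unfolding has_field_derivative_def
    by (rule_tac has_derivative_subset) (auto simp: domain_def)
  ultimately have G: "((\<lambda>v. G (v $ 2)) has_derivative (\<lambda>e. G' (v $ 2) * e $ 2)) (at v within domain)"
    by (rule has_derivative_in_compose)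
  show ?thesis
    unfolding graph_def graph_deriv_def
    by (intro has_derivative_Pair)
       (auto intro!: derivative_eq_intros G bounded_linear_imp_has_derivative bounded_linear_vec_nth)
qed

lemma convex_domain: "convex domain"
  using interval unfolding domain_def is_interval_convex_1[symmetric]
  by (auto simp: convex_def is_interval_convex_1)

lemma interior_domain: "interior domain \<noteq> {}"
proof -
  have "open {v :: real^2. v $ 2 \<in> interior I}"
    using open_vimage_vec_nth[of "interior I" 2] by (simp add: vimage_def)
  then have "{v. v $ 2 \<in> interior I} \<subseteq> interior domain"
    using interior_subset by (intro interior_maximal) (auto simp: domain_def)
  moreover obtain t where "t \<in> interior I" using interior by blast
  then have "vector [0, t] \<in> {v :: real^2. v $ 2 \<in> interior I}" by simp
  ultimately show ?thesis by blast
qed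

text \<open>The frame coordinates of the tangent vectors are \<open>(G, 1, 0)\<close> and \<open>(y G', 0, c)\<close> with
  \<open>c = 1 + y\<^sup>2 G' / 2\<close>. Here \<open>G' \<ge> 0\<close> enters through \<open>\<bar>c\<bar> = c\<close>.\<close>

lemma horizontal_norm_normal_graph:
  assumes "v \<in> domain"
  shows "horizontal_norm (normal (graph v) (graph_deriv v))
       = sqrt (1 + (G (v $ 2))\<^sup>2) * (1 + (v $ 1)\<^sup>2 * G' (v $ 2) / 2)"
proof -
  define c where "c = 1 + (v $ 1)\<^sup>2 * G' (v $ 2) / 2"
  have "normal (graph v) (graph_deriv v) = (c, - G (v $ 2) * c, - v $ 1 * G' (v $ 2))"
    by (simp add: normal_def graph_def graph_deriv_def axis_def c_def power2_eq_square field_simps)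
  moreover have "0 \<le> c"
    using assms deriv_nonneg by (simp add: c_def domain_def)
  moreover have "c\<^sup>2 + (- G (v $ 2) * c)\<^sup>2 = (1 + (G (v $ 2))\<^sup>2) * c\<^sup>2"
    by algebra
  ultimately show ?thesis
    by (simp add: horizontal_norm_def real_sqrt_mult c_def)
qed

text \<open>The line over \<open>t\<close> has Euclidean arc length \<open>s = tilt t * y\<close>. Outside \<open>I\<close>, where \<open>G\<close> is
  arbitrary, \<open>tilt\<close> and \<open>twist\<close> are given constant values to make them Borel functions on the line.\<close>

definition tilt :: "real \<Rightarrow> real" where
  "tilt t = (if t \<in> I then sqrt (1 + (G t)\<^sup>2) else 1)"

text \<open>Half the derivative of the angle \<open>arctan G\<close> by which the strip turns about its axis.\<close>

definition twist :: "real \<Rightarrow> real" where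
  "twist t = (if t \<in> I then G' t / (2 * (1 + (G t)\<^sup>2)) else 0)"

lemma borel_interval: "I \<in> sets borel"
  using interval by (rule real_interval_borel_measurable)

lemma borel_tilt [measurable]: "tilt \<in> borel_measurable borel"
  unfolding tilt_def
  by (intro borel_measurable_continuous_on_if borel_interval continuous_intros cont_G)

lemma borel_twist [measurable]: "twist \<in> borel_measurable borel"
  unfolding twist_def
  by (intro borel_measurable_continuous_on_if borel_interval continuous_intros cont_G cont_deriv)
     (auto simp: add_nonneg_eq_0_iff)

lemma twist_nonneg: "0 \<le> twist t"
  using deriv_nonneg by (simp add: twist_def)

lemma twist_outside: "t \<notin> I \<Longrightarrow> twist t = 0"
  by (simp add: twist_def)

lemma tilt_pos: "0 < tilt t"
  by (simp add: tilt_def add_pos_nonneg)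

end

locale placed_strip = strip +
  fixes q :: heis and \<theta> :: real and S :: "heis set"
  assumes S: "S = hmul q ` rot \<theta> ` strip_x I G"
begin

definition param :: "real^2 \<Rightarrow> heis" where
  "param v = hmul q (rot \<theta> (graph v))"

definition param_deriv :: "real^2 \<Rightarrow> real^2 \<Rightarrow> heis" where
  "param_deriv v e = left_deriv q (rot \<theta> (graph_deriv v e))"

definition coords :: "heis \<Rightarrow> real^2" where
  "coords p = vector [fst (snd p), snd (snd p)]"

definition chart :: "heis \<Rightarrow> real^2" where
  "chart p = coords (rot (- \<theta>) (hmul (hinv q) p))"

definition chart_deriv :: "heis \<Rightarrow> real^2" where
  "chart_deriv e = coords (rot (- \<theta>) (left_deriv (hinv q) e))"

lemma linear_coords: "linear coords"
  by (rule linearI) (auto simp: coords_def vec_eq_iff forall_2)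

lemma chart_param: "chart (param v) = v"
  by (simp add: chart_def param_def hmul_hinv_cancel rot_minus_rot)
     (simp add: coords_def graph_def vec_eq_iff forall_2)

lemma der_chart: "(chart has_derivative chart_deriv) (at p)"
proof -
  have "bounded_linear (\<lambda>e. coords (rot (- \<theta>) e))"
    using linear_compose[OF linear_rot linear_coords]
    by (simp add: o_def linear_conv_bounded_linear)
  moreover have "(hmul (hinv q) has_derivative left_deriv (hinv q)) (at p)"
    unfolding hmul_eq_affine using linear_left_deriv[of "hinv q"]
    by (auto intro!: derivative_eq_intros bounded_linear_imp_has_derivative simp: linear_conv_bounded_linear)
  ultimately show ?thesis
    unfolding chart_def chart_deriv_def by (rule bounded_linear.has_derivative)
qed

lemma der_param:
  assumes "v \<in> domain"
  shows "(param has_derivative param_deriv v) (at v within domain)"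
proof -
  have lin: "bounded_linear (\<lambda>e. left_deriv q (rot \<theta> e))"
    using linear_compose[OF linear_rot linear_left_deriv]
    by (simp add: o_def linear_conv_bounded_linear)
  show ?thesis
    unfolding param_def param_deriv_def hmul_eq_affine
    using bounded_linear.has_derivative[OF lin der_graph[OF assms]]
    by (auto intro!: derivative_eq_intros)
qed

lemma chart_deriv_param_deriv: "chart_deriv (param_deriv v e) = e"
proof -
  have "left_deriv (hinv q) (left_deriv q w) = w" for w
    by (cases q; cases w) (simp add: field_simps)
  then show ?thesis
    by (simp add: chart_deriv_def param_deriv_def rot_minus_rot)
       (simp add: coords_def graph_deriv_def vec_eq_iff forall_2)
qed

lemma param_image: "param ` domain = S"
proof -
  have "graph ` domain = strip_x I G"
  proof (intro subset_antisym subsetI)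
    fix p assume "p \<in> strip_x I G"
    then obtain y t where "p = (y * G t, y, t)" "t \<in> I" by (auto simp: strip_x_def)
    then show "p \<in> graph ` domain"
      by (intro image_eqI[of _ _ "vector [y, t]"]) (auto simp: graph_def domain_def)
  qed (auto simp: graph_def domain_def strip_x_def)
  then show ?thesis
    by (simp add: S image_image param_def flip: \<open>graph ` domain = _\<close>)
qed

sublocale surface_chart domain param param_deriv S chart "\<lambda>_. chart_deriv"
proof
  show "C1_parametrization domain param param_deriv S"
    unfolding C1_parametrization_def
  proof (intro conjI ballI allI)
    show "negligible (frontier domain)"
      using convex_domain by (rule negligible_convex_frontier)
    show "bij_betw param domain S"
      using param_image chart_param by (metis bij_betw_def inj_on_def)
    show "inj (param_deriv v)" for v
      using chart_deriv_param_deriv by (metis inj_def)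
    have proj: "continuous_on domain (\<lambda>v. f (v $ 2))" if "continuous_on I f" for f :: "real \<Rightarrow> real"
      using that by (rule continuous_on_compose2) (auto intro!: continuous_intros simp: domain_def)
    have lin: "bounded_linear (\<lambda>e. left_deriv q (rot \<theta> e))"
      using linear_compose[OF linear_rot linear_left_deriv]
      by (simp add: o_def linear_conv_bounded_linear)
    show "continuous_on domain (\<lambda>v. param_deriv v e)" for e
      unfolding param_deriv_def
      by (rule bounded_linear.continuous_on[OF lin])
         (auto simp: graph_deriv_def intro!: continuous_intros proj cont_G cont_deriv)
  qed (rule der_param)
qed (auto intro: convex_domain chart_param der_chart simp: interior_domain)

text \<open>In the arc length coordinate \<open>s = tilt t * y\<close> the function \<open>G\<close> enters the density only through
  \<open>twist\<close>: the leading factor \<open>tilt t\<close> is the Jacobian \<open>ds / dy\<close>.\<close>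

lemma perimeter_density_eq:
  assumes "v \<in> domain"
  shows "perimeter_density v = tilt (v $ 2) * (1 + (tilt (v $ 2) * v $ 1)\<^sup>2 * twist (v $ 2))"
proof -
  have v: "v $ 2 \<in> I" using assms by (simp add: domain_def)
  have pos: "0 < 1 + (G (v $ 2))\<^sup>2"
    by (simp add: add_pos_nonneg)
  have "perimeter_density v = sqrt (1 + (G (v $ 2))\<^sup>2) * (1 + (v $ 1)\<^sup>2 * G' (v $ 2) / 2)"
    unfolding perimeter_density_def param_def param_deriv_def
    using assms by (simp only: horizontal_norm_normal_invariant horizontal_norm_normal_graph)
  also have "(v $ 1)\<^sup>2 * G' (v $ 2) / 2 = (tilt (v $ 2) * v $ 1)\<^sup>2 * twist (v $ 2)"
  proof -
    have "(tilt (v $ 2))\<^sup>2 = 1 + (G (v $ 2))\<^sup>2"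
      using v pos by (simp add: tilt_def)
    moreover have "(1 + (G (v $ 2))\<^sup>2) * twist (v $ 2) = G' (v $ 2) / 2"
    proof -
      have "a * (g / (2 * a)) = g / 2" if "0 < a" for a g :: real
        using that by simp
      from this[OF pos] v show ?thesis by (simp only: twist_def if_True)
    qed
    ultimately show ?thesis
      by (simp add: power_mult_distrib)
  qed
  finally show ?thesis
    using v by (simp add: tilt_def)
qed

lemma param_mem_gauge_ball_iff:
  assumes "v \<in> domain" "0 < r"
  shows "param v \<in> gauge_ball (hmul q (0, 0, t0)) r
     \<longleftrightarrow> (tilt (v $ 2) * v $ 1) ^ 4 + 16 * (v $ 2 - t0)\<^sup>2 < r ^ 4"
proof -
  have "(tilt (v $ 2) * v $ 1) ^ 4 = ((tilt (v $ 2))\<^sup>2 * (v $ 1)\<^sup>2)\<^sup>2"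
    by algebra
  also have "(tilt (v $ 2))\<^sup>2 * (v $ 1)\<^sup>2 = (v $ 1 * G (v $ 2))\<^sup>2 + (v $ 1)\<^sup>2"
    using assms by (simp add: tilt_def domain_def algebra_simps power_mult_distrib)
  finally show ?thesis
    unfolding param_def graph_def mem_gauge_ball_iff[OF assms(2)] by simp
qed

text \<open>After substituting \<open>s = tilt t * y\<close> in the inner integral, the perimeter is in the form to which
  \<open>nn_integral_strip_scaling\<close> applies.\<close>

lemma emeasure_strip_gauge_ball:
  assumes r: "0 < r" "{t0 - r\<^sup>2 / 4 <..< t0 + r\<^sup>2 / 4} \<subseteq> I"
  shows "emeasure (sigma_H S) (S \<inter> gauge_ball (hmul q (0, 0, t0)) r)
       = ennreal (r ^ 3) * (gauge_area + strip_excess twist t0 r)"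
proof -
  let ?B = "gauge_ball (hmul q (0, 0, t0)) r"
  note borel_interval [measurable]
  define F where "F t s = indicator I t * ennreal (1 + s\<^sup>2 * twist t) * indicator {..<r ^ 4} (s ^ 4 + 16 * (t - t0)\<^sup>2)"
    for t s :: real
  have F [measurable]: "(\<lambda>x. F (f x) (g x)) \<in> borel_measurable M"
    if [measurable]: "f \<in> borel_measurable M" "g \<in> borel_measurable M" for f g and M :: "'b measure"
    unfolding F_def by measurable
  have density: "ennreal (perimeter_density v * indicator ?B (param v)) * indicator domain v
     = ennreal (tilt (v $ 2)) * F (v $ 2) (tilt (v $ 2) * v $ 1)" for v
  proof (cases "v \<in> domain")
    case True
    then show ?thesis
      using r(1) tilt_pos[of "v $ 2"]
      by (auto simp: perimeter_density_eq F_def indicator_def param_mem_gauge_ball_iff ennreal_mult' domain_def)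
  next
    case False
    then show ?thesis by (simp add: F_def domain_def)
  qed
  have [measurable]: "(\<lambda>v :: real^2. v $ i) \<in> borel_measurable borel" for i
    by (intro borel_measurable_continuous_onI continuous_intros)
  have "emeasure (sigma_H S) (S \<inter> ?B)
      = (\<integral>\<^sup>+v. ennreal (perimeter_density v * indicator ?B (param v)) \<partial>lebesgue_on domain)"
    using borel_gauge_ball by (rule emeasure_sigma_H)
  also have "\<dots> = (\<integral>\<^sup>+v. ennreal (tilt ((v :: real^2) $ 2)) * F (v $ 2) (tilt (v $ 2) * v $ 1) \<partial>lborel)"
  proof -
    have "domain \<in> sets lebesgue"
      by (intro sets_lebesgue_negligible_frontier negligible_convex_frontier convex_domain)
    then show ?thesis
      by (subst nn_integral_restrict_space) (simp_all add: density nn_integral_completion)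
  qed
  also have "\<dots> = (\<integral>\<^sup>+t. \<integral>\<^sup>+y. ennreal (tilt t) * F t (tilt t * y) \<partial>lborel \<partial>lborel)"
    by (subst nn_integral_lborel_real2) simp_all
  also have "\<dots> = (\<integral>\<^sup>+t. \<integral>\<^sup>+s. F t s \<partial>lborel \<partial>lborel)"
  proof (rule nn_integral_cong)
    fix t :: real
    show "(\<integral>\<^sup>+y. ennreal (tilt t) * F t (tilt t * y) \<partial>lborel) = (\<integral>\<^sup>+s. F t s \<partial>lborel)"
      using tilt_pos[of t] nn_integral_real_affine[of "F t" "tilt t" 0]
      by (simp add: nn_integral_cmult)
  qed
  also have "\<dots> = ennreal (r ^ 3) * (gauge_area + strip_excess twist t0 r)"
    unfolding F_def using borel_twist twist_nonneg twist_outside r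
    by (rule nn_integral_strip_scaling)
  finally show ?thesis .
qed

end

text \<open>The two descriptions of the derivative of \<open>G\<close>, as a continuous function and as a nonnegative
  number at each point, agree because every point of a nondegenerate interval is a limit point of
  it.\<close>

lemma graphical_strip_imp_placed_strip:
  assumes "graphical_strip 2 q S"
  obtains I G G' \<theta> where "placed_strip I G G' q \<theta> S"
proof -
  obtain I G \<theta> where I: "is_interval I" "interior I \<noteq> {}" and C2: "Ck_on 2 I G"
    and mono: "\<And>t. t \<in> I \<Longrightarrow> \<exists>d\<ge>0. (G has_real_derivative d) (at t within I)"
    and S: "S = hmul q ` rot \<theta> ` strip_x I G \<or> S = hmul q ` rot \<theta> ` strip_y I G"
    using assms unfolding graphical_strip_def by blast
  obtain G' where G': "\<And>t. t \<in> I \<Longrightarrow> (G has_real_derivative G' t) (at t within I)" and C1: "Ck_on 1 I G'"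
    using C2 by (auto simp: numeral_2_eq_2)
  have "continuous_on I G'"
    using C1 by (auto intro: DERIV_continuous_on)
  moreover have "0 \<le> G' t" if t: "t \<in> I" for t
  proof -
    obtain d where d: "0 \<le> d" "(G has_real_derivative d) (at t within I)"
      using mono[OF t] by blast
    have "I \<noteq> {x}" for x
      using I(2) by auto
    then have "t islimpt I"
      using I(1) t by (intro connected_imp_perfect) (auto simp: is_interval_connected_1)
    then have "at t within I \<noteq> bot"
      by (simp add: trivial_limit_within)
    then have "G' t = d"
      using G'[OF t] d(2) by (metis has_field_derivative_unique)
    then show ?thesis using d(1) by simp
  qed
  ultimately have strip: "strip I G G'"
    using I G' by unfold_locales auto
  obtain \<theta>' where "S = hmul q ` rot \<theta>' ` strip_x I G"
    using S by (auto simp: strip_y_eq_rot image_image rot_rot)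
  then have "placed_strip I G G' q \<theta>' S"
    using strip by (simp add: placed_strip_def placed_strip_axioms_def)
  then show ?thesis by (rule that)
qed

theorem theorem1p3:
  fixes S :: "heis set" and q :: heis
  assumes "graphical_strip 2 q S"
  shows "(\<forall>t0. hmul q (0, 0, t0) \<in> S \<longrightarrow>
            mono_on (strip_radii q S (hmul q (0, 0, t0)))
              (\<lambda>r. emeasure (sigma_H S) (S \<inter> gauge_ball (hmul q (0, 0, t0)) r)
                     / ennreal (r ^ (hom_dim - 1))))
       \<and> (\<exists>\<omega>>0. \<forall>t0. hmul q (0, 0, t0) \<in> S \<longrightarrow>
            (\<forall>r \<in> strip_radii q S (hmul q (0, 0, t0)).
               emeasure (sigma_H S) (S \<inter> gauge_ball (hmul q (0, 0, t0)) r)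
                 \<ge> ennreal (\<omega> * r ^ (hom_dim - 1))))"
proof -
  obtain I G G' \<theta> where strip: "placed_strip I G G' q \<theta> S"
    using graphical_strip_imp_placed_strip[OF assms] .
  interpret placed_strip I G G' q \<theta> S
    by (fact strip)
  have radii: "0 < r \<and> {t0 - r\<^sup>2 / 4 <..< t0 + r\<^sup>2 / 4} \<subseteq> I"
    if "r \<in> strip_radii q S (hmul q (0, 0, t0))" for r t0
    using that strip_radii_interval[of S q \<theta> I G t0] S by auto
  have perimeter: "emeasure (sigma_H S) (S \<inter> gauge_ball (hmul q (0, 0, t0)) r)
      = ennreal (r ^ (hom_dim - 1)) * (gauge_area + strip_excess twist t0 r)"
    if "r \<in> strip_radii q S (hmul q (0, 0, t0))" for r t0
    using emeasure_strip_gauge_ball radii[OF that] by (simp add: hom_dim_def)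
  show ?thesis
  proof (intro conjI allI impI exI[of _ "1/4"] ballI mono_onI)
    fix t0 r s
    assume r: "r \<in> strip_radii q S (hmul q (0, 0, t0))" and s: "s \<in> strip_radii q S (hmul q (0, 0, t0))"
      and "r \<le> s"
    have quotient: "emeasure (sigma_H S) (S \<inter> gauge_ball (hmul q (0, 0, t0)) r) / ennreal (r ^ (hom_dim - 1))
        = gauge_area + strip_excess twist t0 r"
      if "r \<in> strip_radii q S (hmul q (0, 0, t0))" for r
      using radii[OF that]
      unfolding perimeter[OF that] by (subst mult.commute) (simp add: ennreal_mult_divide_eq)
    show "emeasure (sigma_H S) (S \<inter> gauge_ball (hmul q (0, 0, t0)) r) / ennreal (r ^ (hom_dim - 1))
        \<le> emeasure (sigma_H S) (S \<inter> gauge_ball (hmul q (0, 0, t0)) s) / ennreal (s ^ (hom_dim - 1))"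
      unfolding quotient[OF r] quotient[OF s]
      using radii[OF r] \<open>r \<le> s\<close> by (intro add_left_mono strip_excess_mono) auto
  next
    fix t0 r
    assume r: "r \<in> strip_radii q S (hmul q (0, 0, t0))"
    have "ennreal (1 / 4 * r ^ (hom_dim - 1)) = ennreal (r ^ (hom_dim - 1)) * ennreal (1 / 4)"
      using radii[OF r] by (simp add: ennreal_mult[symmetric] mult.commute)
    also have "\<dots> \<le> ennreal (r ^ (hom_dim - 1)) * (gauge_area + strip_excess twist t0 r)"
      using gauge_area_ge by (intro mult_left_mono add_increasing2) auto
    finally show "ennreal (1 / 4 * r ^ (hom_dim - 1)) \<le> emeasure (sigma_H S) (S \<inter> gauge_ball (hmul q (0, 0, t0)) r)"
      unfolding perimeter[OF r] .
  qed simp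
qed

end
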